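(* Let $n\ge 3$ be an integer and let $D=(\mathcal{W}_0,\ldots,\mathcal{W}_n)\in\mathbb{C}^{n+1}$ be a non-zero vector, with associated linear form $P_D(\mathcal{Z}_0,\ldots,\mathcal{Z}_n)=\mathcal{W}_0\mathcal{Z}_0+\cdots+\mathcal{W}_n\mathcal{Z}_n$. Then $$m(P_D)=\log c(D)-\frac12S_D(0),\qquad\text{where}\quad S_D(0)=\sum_{j=1}^{\infty}\frac{2}{j}\sum_{k=0}^{j}\binom{j+k-1}{k}\binom{j}{k}\frac{(-1)^k a(n,k,D)}{c(D)^{2k}}.$$
   Context: $c(D)>0$ is defined by $c(D)^2=(n+1)\|D\|^2$, where $\|D\|^2=|\mathcal{W}_0|^2+\cdots+|\mathcal{W}_n|^2$. For integers $k\ge 0$, $$a(n,k,D)=\sum_{\substack{\ell_0+\cdots+\ell_n=k\\ \ell_m\ge 0}}\binom{k}{\ell_0,\ldots,\ell_n}^2|\mathcal{W}_0|^{2\ell_0}\cdots|\mathcal{W}_n|^{2\ell_n},\qquad \binom{k}{\ell_0,\ldots,\ell_n}=\frac{k!}{\ell_0!\cdots\ell_n!}.$$ The logarithmic Mahler measure of a non-zero polynomial $P\in\mathbb{C}[x_1,\ldots,x_N]$ is $$m(P)=\frac{1}{(2\pi)^N}\int_0^{2\pi}\cdots\int_0^{2\pi}\log|P(e^{i\theta_1},\ldots,e^{i\theta_N})|\,d\theta_1\cdots d\theta_N.$$ For the homogeneous linear form $P_D$ this equals $\frac{1}{(2\pi)^n}\int_0^{2\pi}\cdots\int_0^{2\pi}\log|P_D(1,e^{i\theta_1},\ldots,e^{i\theta_n})|\,d\theta_1\cdots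 d\theta_n$. *)

theory Defs
  imports "HOL-Analysis.Analysis" "HOL-Library.Poly_Mapping"
begin

text \<open>
  Multivariate polynomials are finitely supported maps from monomials (exponent vectors) to
  coefficients; the variables are indexed by natural numbers, so that the polynomial ring in
  \<open>N\<close> variables consists of the polynomials involving only the variables \<open>0, \<dots>, N - 1\<close>.
\<close>

type_synonym cpoly = "(nat \<Rightarrow>\<^sub>0 nat) \<Rightarrow>\<^sub>0 complex"

definition eval_monom :: "(nat \<Rightarrow> complex) \<Rightarrow> (nat \<Rightarrow>\<^sub>0 nat) \<Rightarrow> complex" where
  "eval_monom z e = (\<Prod>i\<in>Poly_Mapping.keys e. z i ^ Poly_Mapping.lookup e i)"

definition eval_cpoly :: "(nat \<Rightarrow> complex) \<Rightarrow> cpoly \<Rightarrow> complex" where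
  "eval_cpoly z P = (\<Sum>e\<in>Poly_Mapping.keys P. Poly_Mapping.lookup P e * eval_monom z e)"

text \<open>
  The argument \<open>N\<close> is the number of variables of the ring in which \<open>P\<close> is considered. The zeros
  of a nonzero \<open>P\<close> on the torus form a null set, so the value of \<open>ln 0\<close> is irrelevant.
\<close>

definition log_mahler_measure :: "nat \<Rightarrow> cpoly \<Rightarrow> real" where
  "log_mahler_measure N P =
     1 / (2 * pi) ^ N *
     (LINT \<theta> : (\<Pi>\<^sub>E i\<in>{..<N}. {0..2 * pi}) | (\<Pi>\<^sub>M i\<in>{..<N}. lborel).
        ln (cmod (eval_cpoly (\<lambda>i. cis (\<theta> i)) P)))"

text \<open>
  Below, a vector \<open>D\<close> of \<open>n + 1\<close> complex numbers is a function on the naturals of which only the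
  values at \<open>0, \<dots>, n\<close> are used.
\<close>

definition linear_form :: "nat \<Rightarrow> (nat \<Rightarrow> complex) \<Rightarrow> cpoly" where
  "linear_form n D = (\<Sum>i\<le>n. Poly_Mapping.single (Poly_Mapping.single i 1) (D i))"

lemma eval_cpoly_superset:
  assumes "finite A" "Poly_Mapping.keys P \<subseteq> A"
  shows "eval_cpoly z P = (\<Sum>e\<in>A. Poly_Mapping.lookup P e * eval_monom z e)"
  unfolding eval_cpoly_def
  using assms by (intro sum.mono_neutral_left) (auto simp: in_keys_iff)

lemma eval_cpoly_0: "eval_cpoly z 0 = 0"
  by (simp add: eval_cpoly_def)

lemma eval_cpoly_add: "eval_cpoly z (P + Q) = eval_cpoly z P + eval_cpoly z Q"
proof -
  let ?A = "Poly_Mapping.keys P \<union> Poly_Mapping.keys Q"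
  have "Poly_Mapping.keys (P + Q) \<subseteq> ?A"
    by (rule Poly_Mapping.keys_add)
  then show ?thesis
    by (simp add: eval_cpoly_superset[where A = ?A] lookup_add distrib_right sum.distrib)
qed

lemma eval_cpoly_sum: "eval_cpoly z (\<Sum>i\<in>A. f i) = (\<Sum>i\<in>A. eval_cpoly z (f i))"
  by (induction A rule: infinite_finite_induct) (simp_all add: eval_cpoly_0 eval_cpoly_add)

lemma eval_cpoly_linear_form: "eval_cpoly z (linear_form n D) = (\<Sum>i\<le>n. D i * z i)"
  unfolding linear_form_def eval_cpoly_sum
  by (intro sum.cong refl) (simp add: eval_cpoly_def eval_monom_def)

definition normD :: "nat \<Rightarrow> (nat \<Rightarrow> complex) \<Rightarrow> real" where
  "normD n D = sqrt (\<Sum>m\<le>n. (cmod (D m))\<^sup>2)"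

definition c_const :: "nat \<Rightarrow> (nat \<Rightarrow> complex) \<Rightarrow> real" where
  "c_const n D = sqrt (real (n + 1) * (normD n D)\<^sup>2)"

definition multinomial :: "nat \<Rightarrow> nat \<Rightarrow> (nat \<Rightarrow> nat) \<Rightarrow> real" where
  "multinomial n k l = fact k / (\<Prod>m\<le>n. fact (l m))"

definition a_coeff :: "nat \<Rightarrow> nat \<Rightarrow> (nat \<Rightarrow> complex) \<Rightarrow> real" where
  "a_coeff n k D =
     (\<Sum>l | l \<in> {..n} \<rightarrow>\<^sub>E (UNIV :: nat set) \<and> (\<Sum>m\<le>n. l m) = k.
        (multinomial n k l)\<^sup>2 * (\<Prod>m\<le>n. cmod (D m) ^ (2 * l m)))"

text \<open>The index set of that sum is finite, so the sum is not zero by convention.\<close>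

lemma finite_compositions:
  fixes n k :: nat
  shows "finite {l. l \<in> {..n} \<rightarrow>\<^sub>E (UNIV :: nat set) \<and> (\<Sum>m\<le>n. l m) = k}"
proof (rule finite_subset)
  have "l i \<le> (\<Sum>m\<le>n. l m)" if "i \<le> n" for l :: "nat \<Rightarrow> nat" and i
    using that by (intro member_le_sum) auto
  then show "{l. l \<in> {..n} \<rightarrow>\<^sub>E (UNIV :: nat set) \<and> (\<Sum>m\<le>n. l m) = k} \<subseteq> {..n} \<rightarrow>\<^sub>E {..k}"
    by (auto simp: PiE_def)
qed (auto intro: finite_PiE)

definition S_term :: "nat \<Rightarrow> (nat \<Rightarrow> complex) \<Rightarrow> nat \<Rightarrow> real" where
  "S_term n D j =
     2 / real j *
     (\<Sum>k\<le>j. real ((j + k - 1) choose k) * real (j choose k) *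
        ((- 1) ^ k * a_coeff n k D / c_const n D ^ (2 * k)))"

definition S0 :: "nat \<Rightarrow> (nat \<Rightarrow> complex) \<Rightarrow> real" where
  "S0 n D = suminf (\<lambda>i. S_term n D (Suc i))"

end

theory Submission
  imports Defs "HOL-Probability.Probability"
begin

text \<open>
  Let \<open>X\<close> be the value of the linear form at a uniformly random point of the torus and
  \<open>u = |X|\<^sup>2 / c\<^sup>2\<close>, which lies in \<open>[0, 1]\<close> by the Cauchy-Schwarz inequality. The moments of \<open>|X|\<^sup>2\<close> are the
  numbers \<open>a(n, k, D)\<close>, so the terms of the series are the expectations of \<open>(2 / j) Q\<^sub>j(u)\<close> with
  \<open>Q\<^sub>j(u) = \<Sum>\<^sub>k binom(j + k - 1, k) binom(j, k) (- u)\<^sup>k\<close>, and the claim is that \<open>- ln u = \<Sum>\<^sub>j (2 / j) Q\<^sub>j(u)\<close>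
  may be integrated term by term. With \<open>u = r\<^sup>2\<close>, the binomial series shows that \<open>Q\<^sub>j(u)\<close> is the mean over
  the circle of \<open>\<zeta>\<^sup>j\<close>, where \<open>\<zeta> = (1 + r e\<^sup>i\<^sup>x) / (1 + r e\<^sup>-\<^sup>i\<^sup>x)\<close> has modulus 1. The partial sums of
  \<open>\<Sum>\<^sub>j Re \<zeta>\<^sup>j / j\<close> converge to \<open>- ln |1 - \<zeta>|\<close> and are bounded by \<open>5 - ln |1 - \<zeta>|\<close>, so dominated
  convergence applies both on the circle and, since \<open>ln |X|\<close> is integrable, on the torus.
\<close>

subsection \<open>The logarithm series on the closed unit disc\<close>

text \<open>The two numbers differ by \<open>(1 - s) * z\<close>, whose norm is at most
  \<open>1 - s * norm z\<close> and hence at most \<open>norm (1 - s * z)\<close>. For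
  \<open>z\<close> other than 1 this keeps the segment from 0 to \<open>z\<close> away from
  1.\<close>

lemma norm_one_minus_le_scaled:
  fixes z :: complex
  assumes "norm z \<le> 1" "0 \<le> s" "s \<le> 1"
  shows "norm (1 - z) \<le> 2 * norm (1 - of_real s * z)"
proof -
  have "norm (1 - z) = norm ((1 - of_real s * z) - of_real (1 - s) * z)"
    by (simp add: algebra_simps)
  also have "\<dots> \<le> norm (1 - of_real s * z) + norm (of_real (1 - s) * z)"
    by (rule norm_triangle_ineq4)
  also have "norm (of_real (1 - s) * z) \<le> 1 - s * norm z"
    using assms mult_left_le[of "norm z" "1 - s"] mult_left_le[of "norm z" s]
    by (simp only: norm_mult norm_of_real) (simp add: algebra_simps)
  also have "1 - s * norm z \<le> norm (1 - of_real s * z)"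
    using norm_triangle_ineq2[of 1 "of_real s * z"] assms by (simp add: norm_mult)
  finally show ?thesis by simp
qed

text \<open>With \<open>z\<close> replaced by \<open>s * z\<close>, the expression under the norm on
  the left becomes \<open>g s\<close>. Its derivative in \<open>s\<close> has norm at most
  \<open>K * s ^ J\<close>, and integrating this over \<open>[0, 1]\<close> gives the factor
  \<open>1 / Suc J\<close>. The estimate includes the boundary of the disc.\<close>

lemma log_partial_sum_remainder:
  fixes z :: complex
  assumes z: "norm z \<le> 1" "z \<noteq> 1"
  shows "norm ((\<Sum>i<J. z ^ Suc i / of_nat (Suc i)) + Ln (1 - z)) \<le> 2 / (real (Suc J) * norm (1 - z))"
proof -
  define K where "K = 2 / norm (1 - z)"
  define g where "g = (\<lambda>s::real. (\<Sum>i<J. (of_real s * z) ^ Suc i / of_nat (Suc i)) + Ln (1 - of_real s * z))"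
  define g' where "g' = (\<lambda>s::real. (\<Sum>i<J. z * (of_real s * z) ^ i) - z / (1 - of_real s * z))"
  have nz: "norm (1 - of_real s * z) > 0" if "0 \<le> s" "s \<le> 1" for s
  proof -
    have "norm (1 - z) > 0" using z(2) by simp
    with norm_one_minus_le_scaled[OF z(1) that] show ?thesis by linarith
  qed
  \<comment> \<open>The segment avoids the branch cut of \<open>Ln\<close>: a non-positive real
    value would give \<open>Re (s * z)\<close> at least 1, which inside the unit disc leaves only
    \<open>s * z = 1\<close>.\<close>
  have re: "1 - of_real s * z \<notin> \<real>\<^sub>\<le>\<^sub>0" if s: "0 \<le> s" "s \<le> 1" for s
  proof
    assume "1 - of_real s * z \<in> \<real>\<^sub>\<le>\<^sub>0"
    then have *: "s * Re z \<ge> 1" "s * Im z = 0" by (auto simp: complex_nonpos_Reals_iff)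
    have "norm (of_real s * z) \<le> 1" using s z(1) mult_le_one[of s "norm z"] by (simp add: norm_mult)
    then have "s * Re z \<le> 1" using complex_Re_le_cmod[of "of_real s * z"] by simp
    with * have "of_real s * z = 1" by (simp add: complex_eq_iff)
    with nz[OF s] show False by simp
  qed
  have der: "(g has_vector_derivative g' s) (at s)" if s: "0 \<le> s" "s \<le> 1" for s
  proof -
    \<comment> \<open>Differentiation takes place in a complex variable \<open>w\<close>, where the
      rule for \<open>Ln\<close> applies; restriction to real arguments follows.\<close>
    have "((\<lambda>w. (\<Sum>i<J. (w * z) ^ Suc i / of_nat (Suc i)) + Ln (1 - w * z)) has_field_derivative g' s)
          (at (of_real s))"
    proof -
      have "((\<lambda>w. \<Sum>i<J. (w * z) ^ Suc i / of_nat (Suc i)) has_field_derivative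
          (\<Sum>i<J. z * (of_real s * z) ^ i)) (at (of_real s))"
        by (rule derivative_eq_intros refl)+ (auto simp: field_simps simp del: of_nat_Suc intro!: sum.cong)
      moreover have "((\<lambda>w. Ln (1 - w * z)) has_field_derivative inverse (1 - of_real s * z) * (- z)) (at (of_real s))"
        by (rule DERIV_chain2[where f = Ln and g = "\<lambda>w. 1 - w * z", OF has_field_derivative_Ln[OF re[OF s]]])
           (rule derivative_eq_intros refl | simp)+
      ultimately have "((\<lambda>w. (\<Sum>i<J. (w * z) ^ Suc i / of_nat (Suc i)) + Ln (1 - w * z)) has_field_derivative
          (\<Sum>i<J. z * (of_real s * z) ^ i) + inverse (1 - of_real s * z) * (- z)) (at (of_real s))"
        by (rule DERIV_add)
      also have "(\<Sum>i<J. z * (of_real s * z) ^ i) + inverse (1 - of_real s * z) * (- z) = g' s"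
        unfolding g'_def by (simp add: divide_inverse mult.commute)
      finally show ?thesis .
    qed
    from has_vector_derivative_real_field[OF this] show ?thesis
      by (simp add: g_def)
  qed
  have bound: "norm (g' s) \<le> K * s ^ J" if s: "0 \<le> s" "s \<le> 1" for s
  proof -
    have ne: "of_real s * z \<noteq> 1" using nz[OF s] by auto
    \<comment> \<open>The geometric sum cancels the derivative of the logarithm except for one term
      of order \<open>J\<close> in \<open>s * z\<close>.\<close>
    have "g' s = z * ((1 - (of_real s * z) ^ J) / (1 - of_real s * z)) - z / (1 - of_real s * z)"
      unfolding g'_def sum_distrib_left[symmetric] using ne by (simp add: sum_gp_strict)
    also have "\<dots> = - z * (of_real s * z) ^ J / (1 - of_real s * z)"
      by (simp add: algebra_simps diff_divide_distrib)
    finally have "g' s = - z * (of_real s * z) ^ J / (1 - of_real s * z)" .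
    then have "norm (g' s) = norm z * (s * norm z) ^ J / norm (1 - of_real s * z)"
      using s by (simp add: norm_mult norm_divide norm_power)
    also have "\<dots> \<le> s ^ J / norm (1 - of_real s * z)"
    proof (rule divide_right_mono)
      have "norm z * (s * norm z) ^ J = s ^ J * norm z ^ Suc J" by (simp add: power_mult_distrib)
      also have "\<dots> \<le> s ^ J"
        using s z(1) by (intro mult_left_le power_le_one) auto
      finally show "norm z * (s * norm z) ^ J \<le> s ^ J" .
    qed auto
    also have "\<dots> = 1 / norm (1 - of_real s * z) * s ^ J" by simp
    also have "\<dots> \<le> K * s ^ J"
    proof (rule mult_right_mono)
      show "1 / norm (1 - of_real s * z) \<le> K"
      using norm_one_minus_le_scaled[OF z(1) s] nz[OF s] z(2) unfolding K_def
        by (simp add: divide_simps split: if_splits)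
    qed (use s in auto)
    finally show ?thesis .
  qed
  have "norm (g 1 - g 0) \<le> K * 1 ^ Suc J / real (Suc J) - K * 0 ^ Suc J / real (Suc J)"
  proof (rule differentiable_bound_general[where f' = g' and \<phi>' = "\<lambda>s. K * s ^ J"])
    show "continuous_on {0..1} g"
      by (rule continuous_on_vector_derivative) (auto intro: der has_vector_derivative_at_within)
    show "continuous_on {0..1} (\<lambda>s. K * s ^ Suc J / real (Suc J))" by (intro continuous_intros) auto
    show "((\<lambda>s. K * s ^ Suc J / real (Suc J)) has_vector_derivative K * x ^ J) (at x)" for x
      unfolding has_real_derivative_iff_has_vector_derivative[symmetric]
      by (rule derivative_eq_intros refl | simp)+
  qed (auto intro: der bound)
  then show ?thesis by (simp add: g_def K_def mult.commute)
qed

text \<open>The remainder bound tends to 0 for fixed \<open>z\<close>, but it blows up like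
  \<open>1 / norm (1 - z)\<close> near 1, which is not integrable on the circle. Domination
  therefore needs the separate logarithmic bound below.\<close>

lemma log_partial_sum_tendsto:
  fixes z :: complex
  assumes "norm z \<le> 1" "z \<noteq> 1"
  shows "(\<lambda>J. Re (\<Sum>i<J. z ^ Suc i / of_nat (Suc i))) \<longlonglongrightarrow> - ln (norm (1 - z))"
proof -
  have "(\<lambda>J. (\<Sum>i<J. z ^ Suc i / of_nat (Suc i)) + Ln (1 - z)) \<longlonglongrightarrow> 0"
  proof (rule Lim_null_comparison)
    show "\<forall>\<^sub>F J in sequentially. norm ((\<Sum>i<J. z ^ Suc i / of_nat (Suc i)) + Ln (1 - z))
        \<le> 2 / norm (1 - z) * inverse (real (Suc J))"
      using log_partial_sum_remainder[OF assms]
      by (intro always_eventually allI)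
         (simp only: divide_inverse inverse_mult_distrib mult.assoc mult.commute[of "inverse (real _)"])
    show "(\<lambda>J. 2 / norm (1 - z) * inverse (real (Suc J))) \<longlonglongrightarrow> 0"
      by (rule tendsto_mult_right_zero[OF LIMSEQ_inverse_real_of_nat])
  qed
  from tendsto_diff[OF this tendsto_const[of "Ln (1 - z)"]]
  have "(\<lambda>J. Re (\<Sum>i<J. z ^ Suc i / of_nat (Suc i))) \<longlonglongrightarrow> Re (- Ln (1 - z))"
    by (intro tendsto_Re) simp
  then show ?thesis using assms by simp
qed

text \<open>Compare with the logarithm series at \<open>r z\<close>, where \<open>1 - r\<close> is the reciprocal of the
  number of terms.\<close>

lemma log_partial_sum_bound:
  fixes z :: complex
  assumes z: "norm z \<le> 1" "z \<noteq> 1"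
  shows "\<bar>Re (\<Sum>i<J. z ^ Suc i / of_nat (Suc i))\<bar> \<le> 5 - ln (norm (1 - z))"
proof -
  define r where "r = real J / real (Suc J)"
  have r: "0 \<le> r" "r < 1" "1 - r = 1 / real (Suc J)" by (auto simp: r_def field_simps)
  define w where "w = of_real r * z"
  have nw: "norm w \<le> r" using z r mult_left_le[of "norm z" r] by (simp add: w_def norm_mult)
  have w1: "1 - r \<le> norm (1 - w)" using norm_triangle_ineq2[of 1 w] nw by simp
  have w: "norm w \<le> 1" "w \<noteq> 1" using nw r by auto
  have zw: "norm (1 - z) \<le> 2 * norm (1 - w)"
    unfolding w_def using z r by (intro norm_one_minus_le_scaled) auto
  \<comment> \<open>By Bernoulli's inequality each of the \<open>J\<close> terms changes by at most
    \<open>1 - r\<close>, and \<open>J * (1 - r) = J / (J + 1)\<close>.\<close>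
  have A: "norm ((\<Sum>i<J. z ^ Suc i / of_nat (Suc i)) - (\<Sum>i<J. w ^ Suc i / of_nat (Suc i))) \<le> 1"
  proof -
    have "norm ((\<Sum>i<J. z ^ Suc i / of_nat (Suc i)) - (\<Sum>i<J. w ^ Suc i / of_nat (Suc i)))
      = norm (\<Sum>i<J. z ^ Suc i / of_nat (Suc i) * of_real (1 - r ^ Suc i))"
      unfolding sum_subtractf[symmetric] w_def power_mult_distrib
      by (intro arg_cong[where f = norm] sum.cong refl) (simp add: field_simps del: power_Suc of_nat_Suc)
    also have "\<dots> \<le> (\<Sum>i<J. 1 - r)"
    proof (rule sum_norm_le)
      fix i
      have "1 - r ^ Suc i \<le> real (Suc i) * (1 - r)"
        using Bernoulli_inequality[of "r - 1" "Suc i"] r by (simp add: algebra_simps del: power_Suc)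
      moreover have "r ^ Suc i \<le> 1" using r by (intro power_le_one) auto
      moreover have "norm z ^ Suc i \<le> 1" using z by (intro power_le_one) auto
      ultimately have "norm z ^ Suc i * (1 - r ^ Suc i) \<le> 1 * (real (Suc i) * (1 - r))"
        by (intro mult_mono) auto
      moreover have "norm (z ^ Suc i / of_nat (Suc i) * of_real (1 - r ^ Suc i))
          = norm z ^ Suc i * (1 - r ^ Suc i) / real (Suc i)"
        using \<open>r ^ Suc i \<le> 1\<close> by (simp add: norm_mult norm_divide norm_power del: power_Suc of_nat_Suc of_real_diff of_real_power)
      ultimately show "norm (z ^ Suc i / of_nat (Suc i) * of_real (1 - r ^ Suc i)) \<le> 1 - r"
        by (simp only: pos_divide_le_eq of_nat_0_less_iff zero_less_Suc mult.commute mult_1)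
    qed
    also have "\<dots> \<le> 1" by (simp add: r(3) field_simps)
    finally show ?thesis .
  qed
  \<comment> \<open>Since \<open>norm (1 - w)\<close> is at least \<open>1 - r = 1 / Suc J\<close>,
    the remainder bound at \<open>w\<close> is at most 2.\<close>
  have B: "norm ((\<Sum>i<J. w ^ Suc i / of_nat (Suc i)) + Ln (1 - w)) \<le> 2"
  proof -
    have "real (Suc J) * norm (1 - w) \<ge> 1" using w1 r by (simp add: field_simps)
    then have "2 / (real (Suc J) * norm (1 - w)) \<le> 2 / 1" by (intro divide_left_mono) auto
    with log_partial_sum_remainder[OF w, of J] show ?thesis by linarith
  qed
  have pos: "norm (1 - z) > 0" "norm (1 - w) > 0" using z w by auto
  have l2: "ln 2 \<le> (1::real)" using ln_le_minus_one[of 2] by simp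
  have "norm (1 - w) \<le> 2" using norm_triangle_ineq4[of 1 w] w by simp
  then have lw: "ln (norm (1 - w)) \<le> ln 2" using pos by simp
  have "norm (1 - z) \<le> 2" using norm_triangle_ineq4[of 1 z] z by simp
  then have lz: "ln (norm (1 - z)) \<le> ln 2" using pos by simp
  have "ln (norm (1 - z)) \<le> ln (2 * norm (1 - w))" using zw pos by simp
  also have "\<dots> = ln 2 + ln (norm (1 - w))" using pos by (simp add: ln_mult)
  \<comment> \<open>The logarithm at \<open>w\<close> is at most \<open>ln 2\<close>, and at least
    the one at \<open>z\<close> minus \<open>ln 2\<close>. The constant 5 of the claim is 1 from
    \<open>A\<close>, 2 from \<open>B\<close> and 2 from here.\<close>
  finally have C: "\<bar>Re (Ln (1 - w))\<bar> \<le> 2 - ln (norm (1 - z))"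
    using w lw lz l2 by (simp only: Re_Ln right_minus_eq)
  have A': "\<bar>Re (\<Sum>i<J. z ^ Suc i / of_nat (Suc i)) - Re (\<Sum>i<J. w ^ Suc i / of_nat (Suc i))\<bar> \<le> 1"
    using order_trans[OF abs_Re_le_cmod A] by (simp del: power_Suc of_nat_Suc Re_sum)
  have B': "\<bar>Re (\<Sum>i<J. w ^ Suc i / of_nat (Suc i)) + Re (Ln (1 - w))\<bar> \<le> 2"
    using order_trans[OF abs_Re_le_cmod B] by (simp del: power_Suc of_nat_Suc Re_sum Re_Ln)
  show ?thesis using A' B' C by linarith
qed

subsection \<open>Integrability of logarithmic singularities\<close>

text \<open>The negative part of the logarithm, because \<open>ennreal\<close> sends negative reals
  to 0. The value \<open>\<infinity>\<close> at non-positive arguments makes the function antitone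
  on the whole line.\<close>

definition neg_log :: "real \<Rightarrow> ennreal" where
  "neg_log x = (if x \<le> 0 then \<infinity> else ennreal (- ln x))"

lemma measurable_neg_log [measurable]: "neg_log \<in> borel_measurable borel"
  unfolding neg_log_def by measurable

lemma neg_log_antimono: "x \<le> y \<Longrightarrow> neg_log y \<le> neg_log x"
  by (auto simp: neg_log_def intro!: ennreal_leI)

lemma neg_log_mult_le: "neg_log (x * y) \<le> neg_log x + neg_log y"
proof (cases "x > 0 \<and> y > 0")
  case True
  have "ennreal (- ln x - ln y) \<le> ennreal (max 0 (- ln x) + max 0 (- ln y))"
    by (intro ennreal_leI) auto
  also have "\<dots> = ennreal (- ln x) + ennreal (- ln y)"
    by (subst ennreal_plus) (auto simp: max_def ennreal_neg)
  finally show ?thesis using True mult_pos_pos[of x y] by (simp add: neg_log_def ln_mult not_le[symmetric])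
next
  case False
  then show ?thesis by (auto simp: neg_log_def)
qed

lemma neg_log_finite: "x > 0 \<Longrightarrow> neg_log x < \<infinity>"
  by (simp add: neg_log_def)

text \<open>A weak form of Jordan's inequality. Monotonicity of \<open>sin t - t * cos t\<close>
  gives \<open>sin (y / 2) \<ge> y / 2 * cos (y / 2)\<close>, and the double angle formulas turn
  this into \<open>sin y \<ge> y * (1 + cos y) / 2\<close>.\<close>

lemma half_le_abs_sin:
  assumes "\<bar>x\<bar> \<le> pi / 2"
  shows "\<bar>x\<bar> / 2 \<le> \<bar>sin x\<bar>"
proof -
  have *: "y / 2 \<le> sin y" if y: "0 \<le> y" "y \<le> pi / 2" for y :: real
  proof (cases "y = 0")
    case False
    have c: "cos (y / 2) > 0" using y pi_gt_zero by (intro cos_gt_zero_pi; linarith)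
    have "sin 0 - 0 * cos 0 \<le> sin (y / 2) - y / 2 * cos (y / 2)"
    proof (rule DERIV_nonneg_imp_nondecreasing[where f = "\<lambda>t. sin t - t * cos t"])
      fix t assume t: "0 \<le> t" "t \<le> y / 2"
      have "((\<lambda>t. sin t - t * cos t) has_real_derivative t * sin t) (at t)"
        by (rule derivative_eq_intros refl | simp)+
      moreover have "t * sin t \<ge> 0" using t y pi_gt_zero by (intro mult_nonneg_nonneg sin_ge_zero; linarith)
      ultimately show "\<exists>d. ((\<lambda>t. sin t - t * cos t) has_real_derivative d) (at t) \<and> 0 \<le> d" by blast
    qed (use y in auto)
    then have "y / 2 * cos (y / 2) \<le> sin (y / 2)" by simp
    then have "y / 2 * cos (y / 2) * cos (y / 2) \<le> sin (y / 2) * cos (y / 2)"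
      using c by (intro mult_right_mono) auto
    moreover have "sin y = 2 * sin (y / 2) * cos (y / 2)" using sin_double[of "y / 2"] by simp
    moreover have "cos y = 2 * cos (y / 2) * cos (y / 2) - 1"
      using cos_double_cos[of "y / 2"] by (simp add: power2_eq_square)
    moreover have "0 \<le> cos y" using y by (intro cos_ge_zero) auto
    moreover have "y * (cos y + 1) \<ge> y" using y \<open>0 \<le> cos y\<close> by (simp add: algebra_simps)
    ultimately show ?thesis by (simp add: algebra_simps)
  qed simp
  show ?thesis
  proof (cases "x \<ge> 0")
    case True then show ?thesis using *[of x] assms by simp
  next
    case False then show ?thesis using *[of "-x"] assms by simp
  qed
qed


text \<open>From \<open>ln y \<le> y\<close> at \<open>y = sqrt (2 / x)\<close> comes the majorant
  \<open>2 * sqrt (2 / x)\<close>, whose integral over \<open>[0, 2]\<close> is 8.\<close>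

lemma nn_integral_neg_log_half_finite: "(\<integral>\<^sup>+x. neg_log (x / 2) * indicator {0..2} x \<partial>lborel) < \<infinity>"
proof -
  have "((\<lambda>x. 2 * sqrt 2 / sqrt x) has_integral (4 * sqrt 2 * sqrt 2 - 4 * sqrt 2 * sqrt 0)) {0..2::real}"
    by (rule fundamental_theorem_of_calculus_interior)
       (auto intro!: continuous_intros derivative_eq_intros simp: field_simps 
             simp flip: has_real_derivative_iff_has_vector_derivative)
  then have "((\<lambda>x. if x \<in> {0..2} then 2 * sqrt 2 / sqrt x else 0) has_integral 8) (UNIV :: real set)"
    by (subst has_integral_restrict_UNIV) (simp add: mult.assoc)
  then have *: "(\<integral>\<^sup>+x. ennreal (if x \<in> {0..2} then 2 * sqrt 2 / sqrt x else 0) \<partial>lborel) = ennreal 8"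
    by (intro nn_integral_has_integral_lborel) auto
  have "(\<integral>\<^sup>+x. neg_log (x / 2) * indicator {0..2} x \<partial>lborel)
      \<le> (\<integral>\<^sup>+x. ennreal (if x \<in> {0..2} then 2 * sqrt 2 / sqrt x else 0) \<partial>lborel)"
  proof (rule nn_integral_mono_AE)
    show "AE x in lborel. neg_log (x / 2) * indicator {0..2} x
        \<le> ennreal (if x \<in> {0..2} then 2 * sqrt 2 / sqrt x else 0)"
      using AE_lborel_singleton[of "0::real"]
    proof eventually_elim
      fix x :: real assume x: "x \<noteq> 0"
      show "neg_log (x / 2) * indicator {0..2} x \<le> ennreal (if x \<in> {0..2} then 2 * sqrt 2 / sqrt x else 0)"
      proof (cases "x \<in> {0..2}")
        case True
        with x have x: "x > 0" by auto
        have "- ln (x / 2) = 2 * ln (sqrt (2 / x))" using x by (simp add: ln_sqrt ln_div)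
        also have "\<dots> \<le> 2 * sqrt (2 / x)"
          using ln_le_minus_one[of "sqrt (2 / x)"] x by simp
        finally show ?thesis using True x
          by (auto simp: neg_log_def real_sqrt_divide intro!: ennreal_leI)
      qed auto
    qed
  qed
  with * show ?thesis by (simp add: order.strict_trans1)
qed

lemma nn_integral_neg_log_sin_period:
  "(\<integral>\<^sup>+x. neg_log \<bar>sin x\<bar> * indicator {of_int k * pi - pi / 2..of_int k * pi + pi / 2} x \<partial>lborel) < \<infinity>"
proof -
  let ?h = "\<lambda>x. neg_log (x / 2) * indicator {0..2} (x::real)"
  have "(\<integral>\<^sup>+x. neg_log \<bar>sin x\<bar> * indicator {of_int k * pi - pi / 2..of_int k * pi + pi / 2} x \<partial>lborel)
      = (\<integral>\<^sup>+x. neg_log \<bar>sin x\<bar> * indicator {- pi / 2..pi / 2} x \<partial>lborel)"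
  \<comment> \<open>Translation by \<open>k * pi\<close> at most changes the sign of
    \<open>sin\<close>.\<close>
  proof (subst nn_integral_real_affine[where c = 1 and t = "of_int k * pi"])
    have "sin (of_int k * pi) = 0" by (simp add: sin_zero_iff_int2)
    then have "\<bar>sin (of_int k * pi + x)\<bar> = \<bar>sin x\<bar>" for x
      using sin_zero_abs_cos_one[of "of_int k * pi"] by (simp add: sin_add abs_mult)
    then show "ennreal \<bar>1\<bar> * (\<integral>\<^sup>+x. neg_log \<bar>sin (of_int k * pi + 1 * x)\<bar> *
        indicator {of_int k * pi - pi / 2..of_int k * pi + pi / 2} (of_int k * pi + 1 * x) \<partial>lborel)
      = (\<integral>\<^sup>+x. neg_log \<bar>sin x\<bar> * indicator {- pi / 2..pi / 2} x \<partial>lborel)"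
      by (auto intro!: nn_integral_cong split: split_indicator)
  qed auto
  \<comment> \<open>One copy of \<open>?h\<close> covers positive \<open>x\<close>, the reflected
    one negative \<open>x\<close>; \<open>pi / 2 < 2\<close> keeps both in range. The reflection is
    written in the affine form that the substitution rule expects.\<close>
  also have "\<dots> \<le> (\<integral>\<^sup>+x. ?h x + ?h (0 + - 1 * x) \<partial>lborel)"
  proof (rule nn_integral_mono)
    fix x :: real
    have "neg_log \<bar>sin x\<bar> \<le> neg_log (\<bar>x\<bar> / 2)" if "x \<in> {- pi / 2..pi / 2}"
      using that by (intro neg_log_antimono half_le_abs_sin) auto
    then show "neg_log \<bar>sin x\<bar> * indicator {- pi / 2..pi / 2} x \<le> ?h x + ?h (0 + - 1 * x)"
      using pi_half_less_two by (auto split: split_indicator simp: abs_if split: if_splits)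
  qed
  also have "\<dots> = (\<integral>\<^sup>+x. ?h x \<partial>lborel) + (\<integral>\<^sup>+x. ?h (0 + - 1 * x) \<partial>lborel)"
    by (rule nn_integral_add) auto
  also have "(\<integral>\<^sup>+x. ?h (0 + - 1 * x) \<partial>lborel) = (\<integral>\<^sup>+x. ?h x \<partial>lborel)"
    by (subst nn_integral_real_affine[where f = ?h and c = "-1" and t = 0]) auto
  also have "(\<integral>\<^sup>+x. ?h x \<partial>lborel) + (\<integral>\<^sup>+x. ?h x \<partial>lborel) < \<infinity>"
    using nn_integral_neg_log_half_finite by simp
  finally show ?thesis .
qed

text \<open>The interval is \<open>[0, 2 * pi]\<close> enlarged by \<open>2 * pi\<close> on both
  sides, to leave room for the later phase shifts. Intervals of length \<open>pi\<close> around the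
  zeros of \<open>sin\<close> cover it; rounding \<open>x / pi\<close> selects one containing
  \<open>x\<close>.\<close>

lemma nn_integral_neg_log_sin_finite:
  "(\<integral>\<^sup>+x. neg_log \<bar>sin x\<bar> * indicator {- 2 * pi..4 * pi} x \<partial>lborel) < \<infinity>"
proof -
  let ?I = "\<lambda>k::int. {of_int k * pi - pi / 2..of_int k * pi + pi / 2}"
  have cover: "\<exists>k\<in>{-2..4::int}. x \<in> ?I k" if x: "x \<in> {- 2 * pi..4 * pi}" for x
  proof
    show "x \<in> ?I (round (x / pi))"
      using of_int_round_le[of "x / pi"] of_int_round_ge[of "x / pi"] pi_gt_zero
      by (auto simp: field_simps)
    have "- 2 \<le> x / pi" "x / pi \<le> 4" using x pi_gt_zero by (auto simp: field_simps)
    from this[THEN round_mono] show "round (x / pi) \<in> {-2..4}" by simp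
  qed
  have "(\<integral>\<^sup>+x. neg_log \<bar>sin x\<bar> * indicator {- 2 * pi..4 * pi} x \<partial>lborel)
      \<le> (\<integral>\<^sup>+x. (\<Sum>k\<in>{-2..4}. neg_log \<bar>sin x\<bar> * indicator (?I k) x) \<partial>lborel)"
  proof (rule nn_integral_mono)
    fix x :: real
    show "neg_log \<bar>sin x\<bar> * indicator {- 2 * pi..4 * pi} x
        \<le> (\<Sum>k\<in>{-2..4}. neg_log \<bar>sin x\<bar> * indicator (?I k) x)"
    proof (cases "x \<in> {- 2 * pi..4 * pi}")
      case True
      with cover obtain k where k: "k \<in> {-2..4}" "x \<in> ?I k" by blast
      then have "neg_log \<bar>sin x\<bar> * indicator {- 2 * pi..4 * pi} x = neg_log \<bar>sin x\<bar> * indicator (?I k) x"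
        using True by simp
      also have "\<dots> \<le> (\<Sum>k\<in>{-2..4}. neg_log \<bar>sin x\<bar> * indicator (?I k) x)"
        using k by (intro member_le_sum) auto
      finally show ?thesis .
    qed simp
  qed
  also have "\<dots> = (\<Sum>k\<in>{-2..4}. \<integral>\<^sup>+x. neg_log \<bar>sin x\<bar> * indicator (?I k) x \<partial>lborel)"
    by (rule nn_integral_sum) auto
  also have "\<dots> < \<infinity>"
    using nn_integral_neg_log_sin_period by (simp add: ennreal_sum_less_top)
  finally show ?thesis .
qed

subsection \<open>Uniform measure on the circle\<close>

text \<open>Points of the circle are represented by real angles, with the whole line as space. The
  normalisation absorbs one factor \<open>1 / (2 * pi)\<close> of the Mahler measure per
  variable.\<close>

definition circle :: "real measure" where
  "circle = uniform_measure lborel {0..2 * pi}"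

lemma sets_circle [measurable_cong, simp]: "sets circle = sets borel"
  by (simp add: circle_def)

lemma space_circle [simp]: "space circle = UNIV"
  by (simp add: circle_def)

lemma prob_space_circle: "prob_space circle"
  unfolding circle_def using pi_gt_zero by (intro prob_space_uniform_measure) auto

interpretation circle: prob_space circle
  by (rule prob_space_circle)

lemma nn_integral_circle:
  "f \<in> borel_measurable borel \<Longrightarrow>
    (\<integral>\<^sup>+x. f x \<partial>circle) = (\<integral>\<^sup>+x. f x * indicator {0..2 * pi} x \<partial>lborel) / ennreal (2 * pi)"
  unfolding circle_def by (subst nn_integral_uniform_measure) auto

lemma integral_uniform_measure:
  fixes f :: "'a \<Rightarrow> 'b::{banach, second_countable_topology}"
  assumes [measurable]: "A \<in> sets M" "f \<in> borel_measurable M"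
    and A: "emeasure M A \<noteq> 0" "emeasure M A \<noteq> \<infinity>"
  shows "(\<integral>x. f x \<partial>uniform_measure M A) = (LINT x:A|M. f x) /\<^sub>R measure M A"
proof -
  have eA: "emeasure M A = ennreal (measure M A)" using A(2) by (intro emeasure_eq_ennreal_measure) auto
  then have pos: "measure M A > 0" using A(1) by (simp add: zero_less_measure_iff)
  \<comment> \<open>\<open>integral_density\<close> needs a real-valued density, whereas the
    definition divides in \<open>ennreal\<close>.\<close>
  have density: "uniform_measure M A = density M (\<lambda>x. ennreal (indicator A x / measure M A))"
    unfolding uniform_measure_def
  proof (intro density_cong AE_I2)
    fix x
    have "ennreal (indicator A x) / ennreal (measure M A) = ennreal (indicator A x / measure M A)"
      using pos by (intro divide_ennreal) auto
    then show "indicator A x / emeasure M A = ennreal (indicator A x / measure M A)"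
      by (simp only: ennreal_indicator eA)
  qed measurable
  have "(\<integral>x. f x \<partial>uniform_measure M A) = (\<integral>x. (indicator A x / measure M A) *\<^sub>R f x \<partial>M)"
    by (subst density, subst integral_density) measurable
  also have "\<dots> = (\<integral>x. (indicator A x *\<^sub>R f x) /\<^sub>R measure M A \<partial>M)"
    by (simp only: scaleR_scaleR divide_inverse mult.commute)
  finally show ?thesis by (simp only: integral_scaleR_right set_lebesgue_integral_def)
qed

lemma integral_circle:
  fixes f :: "real \<Rightarrow> 'b::{banach, second_countable_topology}"
  assumes "f \<in> borel_measurable borel"
  shows "(\<integral>x. f x \<partial>circle) = (LINT x:{0..2 * pi}|lborel. f x) /\<^sub>R (2 * pi)"
  unfolding circle_def using assms pi_gt_zero by (subst integral_uniform_measure) auto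

lemma measurable_cis [measurable]: "cis \<in> borel_measurable borel"
  by (intro borel_measurable_continuous_onI continuous_intros)

lemma integrable_cis_circle [simp]: "integrable circle (\<lambda>x. cis (c * x))"
  by (rule circle.integrable_const_bound[where B = 1]) auto

text \<open>Orthogonality of characters: for \<open>k \<noteq> 0\<close> the primitive is again
  \<open>2 * pi\<close>-periodic.\<close>

lemma integral_cis_circle:
  "(\<integral>x. cis (of_int k * x) \<partial>circle) = (if k = 0 then 1 else 0)"
proof (cases "k = 0")
  case True
  then show ?thesis using circle.prob_space by simp
next
  case False
  let ?F = "\<lambda>x. cis (of_int k * x) / (\<i> * of_int k)"
  have "(\<integral>x. indicator {0..2 * pi} x *\<^sub>R cis (of_int k * x) \<partial>lborel) = ?F (2 * pi) - ?F 0"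
  proof (rule integral_FTC_atLeastAtMost)
    fix x
    have "((\<lambda>w. exp (\<i> * of_int k * w) / (\<i> * of_int k)) has_field_derivative exp (\<i> * of_int k * of_real x)) (at (of_real x))"
      using False by (auto intro!: derivative_eq_intros)
    from has_vector_derivative_real_field[OF this]
    show "(?F has_vector_derivative cis (of_int k * x)) (at x within {0..2 * pi})"
      by (simp add: cis_conv_exp mult_ac)
  qed (auto intro!: continuous_intros)
  also have "\<dots> = 0"
    using cis_multiple_2pi[of "of_int k"] by (simp add: mult_ac)
  finally show ?thesis
    using False by (subst integral_circle)
       (auto simp: set_lebesgue_integral_def intro!: borel_measurable_continuous_onI continuous_intros)
qed

text \<open>Dominated convergence with the majorant of \<open>log_partial_sum_bound\<close>.
  Integrating that majorant gives the second claim, which later serves to build the majorant for the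
  integral over the torus.\<close>

lemma (in prob_space) log_series_integral:
  fixes \<zeta> :: "'a \<Rightarrow> complex"
  assumes [measurable]: "\<zeta> \<in> borel_measurable M"
    and le1: "AE x in M. norm (\<zeta> x) \<le> 1 \<and> \<zeta> x \<noteq> 1"
    and int: "integrable M (\<lambda>x. ln (norm (1 - \<zeta> x)))"
  shows "(\<lambda>J. \<Sum>i<J. (\<integral>x. Re (\<zeta> x ^ Suc i) \<partial>M) / real (Suc i)) \<longlonglongrightarrow> - (\<integral>x. ln (norm (1 - \<zeta> x)) \<partial>M)"
    and "\<bar>\<Sum>i<J. (\<integral>x. Re (\<zeta> x ^ Suc i) \<partial>M) / real (Suc i)\<bar> \<le> 5 - (\<integral>x. ln (norm (1 - \<zeta> x)) \<partial>M)"
proof -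
  let ?f = "\<lambda>J x. Re (\<Sum>i<J. \<zeta> x ^ Suc i / of_nat (Suc i))"
  have f: "?f J x = (\<Sum>i<J. Re (\<zeta> x ^ Suc i) / real (Suc i))" for J x
    by (simp add: Re_divide_of_nat del: power_Suc of_nat_Suc)
  have pow: "integrable M (\<lambda>x. Re (\<zeta> x ^ k))" for k
  proof (rule integrable_const_bound[where B = 1])
    show "AE x in M. norm (Re (\<zeta> x ^ k)) \<le> 1"
      using le1
    proof eventually_elim
      case (elim x)
      have "\<bar>Re (\<zeta> x ^ k)\<bar> \<le> norm (\<zeta> x) ^ k" using abs_Re_le_cmod[of "\<zeta> x ^ k"] by (simp add: norm_power)
      also have "\<dots> \<le> 1" using elim by (intro power_le_one) auto
      finally show ?case by simp
    qed
  qed measurable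
  have eq: "(\<Sum>i<J. (\<integral>x. Re (\<zeta> x ^ Suc i) \<partial>M) / real (Suc i)) = (\<integral>x. ?f J x \<partial>M)" for J
    unfolding f using pow by (subst Bochner_Integration.integral_sum) (auto simp del: power_Suc of_nat_Suc)
  have intf: "integrable M (?f J)" for J
    unfolding f using pow by (auto simp del: power_Suc of_nat_Suc)
  have bound: "AE x in M. norm (?f J x) \<le> 5 - ln (norm (1 - \<zeta> x))" for J
    using le1 by eventually_elim (unfold real_norm_def, blast intro: log_partial_sum_bound)
  have "(\<lambda>J. \<integral>x. ?f J x \<partial>M) \<longlonglongrightarrow> (\<integral>x. - ln (norm (1 - \<zeta> x)) \<partial>M)"
  proof (rule integral_dominated_convergence)
    show "AE x in M. (\<lambda>J. ?f J x) \<longlonglongrightarrow> - ln (norm (1 - \<zeta> x))"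
      using le1 by eventually_elim (blast intro: log_partial_sum_tendsto)
    show "AE x in M. norm (?f J x) \<le> 5 - ln (norm (1 - \<zeta> x))" for J by (rule bound)
    show "integrable M (\<lambda>x. 5 - ln (norm (1 - \<zeta> x)))" using int by auto
  qed measurable
  then show "(\<lambda>J. \<Sum>i<J. (\<integral>x. Re (\<zeta> x ^ Suc i) \<partial>M) / real (Suc i)) \<longlonglongrightarrow> - (\<integral>x. ln (norm (1 - \<zeta> x)) \<partial>M)"
    unfolding eq by simp
  have "\<bar>\<integral>x. ?f J x \<partial>M\<bar> \<le> (\<integral>x. \<bar>?f J x\<bar> \<partial>M)"
    by (rule integral_abs_bound)
  also have "\<dots> \<le> (\<integral>x. 5 - ln (norm (1 - \<zeta> x)) \<partial>M)"
    using bound[of J] int intf[of J] by (intro integral_mono_AE) auto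
  also have "\<dots> = 5 - (\<integral>x. ln (norm (1 - \<zeta> x)) \<partial>M)"
    using int by (simp add: prob_space)
  finally show "\<bar>\<Sum>i<J. (\<integral>x. Re (\<zeta> x ^ Suc i) \<partial>M) / real (Suc i)\<bar> \<le> 5 - (\<integral>x. ln (norm (1 - \<zeta> x)) \<partial>M)"
    unfolding eq .
qed

text \<open>The value of \<open>ln 0\<close> is irrelevant: \<open>neg_log 0 = \<infinity>\<close> forces the zeros of \<open>f\<close> to be null.\<close>

lemma (in prob_space) integrable_ln_if_neg_log:
  fixes f :: "'a \<Rightarrow> real"
  assumes [measurable]: "f \<in> borel_measurable M" and fin: "(\<integral>\<^sup>+x. neg_log (f x) \<partial>M) < \<infinity>"
    and ub: "AE x in M. f x \<le> C"
  shows "AE x in M. f x > 0" "integrable M (\<lambda>x. ln (f x))"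
proof -
  have "AE x in M. neg_log (f x) \<noteq> \<infinity>"
    using fin by (intro nn_integral_noteq_infinite) auto
  then show pos: "AE x in M. f x > 0"
    by eventually_elim (auto simp: neg_log_def split: if_splits)
  show "integrable M (\<lambda>x. ln (f x))"
  proof (rule integrableI_bounded)
    have "(\<integral>\<^sup>+x. norm (ln (f x)) \<partial>M) \<le> (\<integral>\<^sup>+x. neg_log (f x) + ennreal \<bar>ln C\<bar> \<partial>M)"
    proof (rule nn_integral_mono_AE)
      show "AE x in M. ennreal (norm (ln (f x))) \<le> neg_log (f x) + ennreal \<bar>ln C\<bar>"
        using pos ub
      proof eventually_elim
        case (elim x)
        have "ln (f x) \<le> ln C" using elim by simp
        then have "norm (ln (f x)) \<le> max 0 (- ln (f x)) + \<bar>ln C\<bar>" by auto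
        then have "ennreal (norm (ln (f x))) \<le> ennreal (max 0 (- ln (f x)) + \<bar>ln C\<bar>)"
          by (rule ennreal_leI)
        also have "\<dots> = neg_log (f x) + ennreal \<bar>ln C\<bar>"
          using elim by (subst ennreal_plus) (auto simp: neg_log_def max_def ennreal_neg)
        finally show ?case .
      qed
    qed
    also have "\<dots> = (\<integral>\<^sup>+x. neg_log (f x) \<partial>M) + ennreal \<bar>ln C\<bar>"
      by (subst nn_integral_add) (auto simp: emeasure_space_1)
    also have "\<dots> < \<infinity>" using fin by simp
    finally show "(\<integral>\<^sup>+x. norm (ln (f x)) \<partial>M) < \<infinity>" .
  qed measurable
qed

text \<open>The bound must be uniform in \<open>s\<close>, since the shift will depend on the
  remaining torus coordinates. A shift by at most \<open>2 * pi\<close> keeps the period inside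
  \<open>[- 2 * pi, 4 * pi]\<close>.\<close>

lemma nn_integral_neg_log_sin_shift:
  obtains K where "K < \<infinity>" "\<And>s. \<bar>s\<bar> \<le> 2 * pi \<Longrightarrow> (\<integral>\<^sup>+x. neg_log \<bar>sin (x + s)\<bar> \<partial>circle) \<le> K"
proof
  let ?K = "\<integral>\<^sup>+x. neg_log \<bar>sin x\<bar> * indicator {- 2 * pi..4 * pi} x \<partial>lborel"
  show "?K / ennreal (2 * pi) < \<infinity>"
    using nn_integral_neg_log_sin_finite pi_gt_zero by (simp add: ennreal_divide_eq_top_iff less_top[symmetric])
  fix s :: real assume s: "\<bar>s\<bar> \<le> 2 * pi"
  have "?K = (\<integral>\<^sup>+x. neg_log \<bar>sin (x + s)\<bar> * indicator {- 2 * pi..4 * pi} (x + s) \<partial>lborel)"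
    by (subst nn_integral_real_affine[where c = 1 and t = s]) (auto simp: add.commute)
  moreover have "(\<integral>\<^sup>+x. neg_log \<bar>sin (x + s)\<bar> * indicator {0..2 * pi} x \<partial>lborel)
     \<le> (\<integral>\<^sup>+x. neg_log \<bar>sin (x + s)\<bar> * indicator {- 2 * pi..4 * pi} (x + s) \<partial>lborel)"
    using s by (intro nn_integral_mono) (auto split: split_indicator)
  ultimately show "(\<integral>\<^sup>+x. neg_log \<bar>sin (x + s)\<bar> \<partial>circle) \<le> ?K / ennreal (2 * pi)"
    by (subst nn_integral_circle) (auto intro!: divide_right_mono_ennreal)
qed

subsection \<open>Expansion of the logarithm in Jacobi polynomials\<close>

text \<open>Absolute summability permits integration term by term, and orthogonality leaves only the
  term \<open>m = k\<close>.\<close>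

lemma integral_cis_power_series_circle:
  fixes a :: "nat \<Rightarrow> complex"
  assumes "r \<ge> 0" and sm: "summable (\<lambda>m. norm (a m * of_real r ^ m))"
  shows "integrable circle (\<lambda>x. cis (real k * x) * suminf (\<lambda>m. a m * (of_real r * cis (- x)) ^ m))"
    and "(\<integral>x. cis (real k * x) * suminf (\<lambda>m. a m * (of_real r * cis (- x)) ^ m) \<partial>circle) = a k * of_real r ^ k"
proof -
  let ?f = "\<lambda>m x. a m * of_real r ^ m * cis (of_int (int k - int m) * x)"
  have int: "integrable circle (?f m)" for m by simp
  have fin: "(\<integral>x. ?f m x \<partial>circle) = (if m = k then a k * of_real r ^ k else 0)" for m
    using integral_cis_circle[of "int k - int m"] by (simp only: integral_mult_right_zero) auto
  have nf: "norm (?f m x) = norm (a m * of_real r ^ m)" for m x by (simp add: norm_mult)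
  have "norm (a m * (of_real r * cis (- x)) ^ m) = norm (a m * of_real r ^ m)" for m x
    by (simp only: norm_mult norm_power norm_cis mult_1_right)
  then have sx: "summable (\<lambda>m. a m * (of_real r * cis (- x)) ^ m)" for x
    using sm by - (rule summable_norm_cancel, simp only:)
  have tm: "cis (real k * x) * (a m * (of_real r * cis (- x)) ^ m) = ?f m x" for m x
  proof -
    have "cis (real k * x) * cis (real m * - x) = cis (of_int (int k - int m) * x)"
      unfolding cis_mult by (simp add: left_diff_distrib)
    then have "a m * of_real r ^ m * (cis (real k * x) * cis (real m * - x)) = ?f m x"
      by (simp only:)
    then show ?thesis
      unfolding power_mult_distrib Complex.DeMoivre by (simp only: mult_ac)
  qed
  have eq: "cis (real k * x) * suminf (\<lambda>m. a m * (of_real r * cis (- x)) ^ m) = suminf (\<lambda>m. ?f m x)" for x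
    unfolding suminf_mult[OF sx, symmetric] tm ..
  have 1: "AE x in circle. summable (\<lambda>m. norm (?f m x))"
    unfolding nf using sm by simp
  have 2: "summable (\<lambda>m. \<integral>x. norm (?f m x) \<partial>circle)"
    unfolding nf using sm circle.prob_space by simp
  show "integrable circle (\<lambda>x. cis (real k * x) * suminf (\<lambda>m. a m * (of_real r * cis (- x)) ^ m))"
    unfolding eq by (rule integrable_suminf[OF int 1 2])
  show "(\<integral>x. cis (real k * x) * suminf (\<lambda>m. a m * (of_real r * cis (- x)) ^ m) \<partial>circle) = a k * of_real r ^ k"
    unfolding eq integral_suminf[OF int 1 2] fin
    by (subst suminf_finite[of "{k}"]) auto
qed

lemma inverse_power_binomial_series:
  fixes z :: complex
  assumes "norm z < 1"
  shows "suminf (\<lambda>m. (- of_nat j gchoose m) * z ^ m) = 1 / (1 + z) ^ j"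
    and "summable (\<lambda>m. norm ((- of_nat j gchoose m) * z ^ m))"
proof -
  have "1 + z \<noteq> 0" using assms by (metis add_eq_0_iff norm_minus_cancel norm_one less_irrefl)
  then have "(1 + z) powr (- of_nat j) = 1 / (1 + z) ^ j"
    by (simp add: powr_minus powr_nat' divide_inverse)
  with gen_binomial_complex[OF assms, of "- of_nat j"]
  show "suminf (\<lambda>m. (- of_nat j gchoose m) * z ^ m) = 1 / (1 + z) ^ j"
    by (simp add: sums_iff)
  \<comment> \<open>Convergence at a radius strictly between \<open>norm z\<close> and 1 yields
    absolute convergence at \<open>z\<close>.\<close>
  define K where "K = (norm z + 1) / 2"
  have K: "norm z < K" "K < 1" "0 \<le> K" using assms by (auto simp: K_def add_nonneg_nonneg)
  have "summable (\<lambda>m. (- of_nat j gchoose m) * (of_real K :: complex) ^ m)"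
    using gen_binomial_complex[of "of_real K" "- of_nat j"] K by (auto simp: sums_iff)
  from powser_insidea[OF this, of z] K
  show "summable (\<lambda>m. norm ((- of_nat j gchoose m) * z ^ m))" by simp
qed

text \<open>The hypergeometric polynomial \<open>F(- j, j; 1; u)\<close>, which is the Jacobi polynomial with parameters
  \<open>(0, - 1)\<close> at \<open>1 - 2 u\<close>.\<close>

definition jacobi_poly :: "nat \<Rightarrow> real \<Rightarrow> real" where
  "jacobi_poly j u = (\<Sum>k\<le>j. real ((j + k - 1) choose k) * real (j choose k) * ((- 1) ^ k * u ^ k))"

lemma gchoose_minus_of_nat:
  assumes "j \<ge> 1"
  shows "(- of_nat j gchoose k) = ((- 1) ^ k * of_nat ((j + k - 1) choose k) :: 'a::field_char_0)"
proof -
  have "of_nat j + of_nat k - 1 = (of_nat (j + k - 1) :: 'a)" using assms by (simp add: of_nat_diff)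
  then show ?thesis by (simp add: gbinomial_minus binomial_gbinomial)
qed

text \<open>Numerator and denominator are conjugate. Writing the conjugate with
  \<open>cis (- x)\<close> makes the inverse powers of the denominator a power series in
  \<open>cis (- x)\<close>.\<close>

definition phase :: "real \<Rightarrow> real \<Rightarrow> complex" where
  "phase r x = (1 + of_real r * cis x) / (1 + of_real r * cis (- x))"

lemma one_plus_cis_neq_0:
  assumes "0 \<le> r" "r < 1"
  shows "1 + of_real r * cis x \<noteq> 0"
proof
  assume "1 + of_real r * cis x = 0"
  then have "of_real r * cis x = - 1" by (simp add: add_eq_0_iff)
  then have "norm (of_real r * cis x) = 1" by simp
  then show False using assms by (simp add: norm_mult)
qed

lemma measurable_phase: "0 \<le> r \<Longrightarrow> r < 1 \<Longrightarrow> phase r \<in> borel_measurable borel"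
  unfolding phase_def using one_plus_cis_neq_0
  by (intro borel_measurable_continuous_onI continuous_intros) auto

lemma norm_phase: "0 \<le> r \<Longrightarrow> r < 1 \<Longrightarrow> norm (phase r x) = 1"
proof -
  assume r: "0 \<le> r" "r < 1"
  have "1 + of_real r * cis (- x) = cnj (1 + of_real r * cis x)" by (simp add: cis_cnj)
  then have "norm (1 + of_real r * cis (- x)) = norm (1 + of_real r * cis x)"
    by (simp only: complex_mod_cnj)
  with one_plus_cis_neq_0[OF r, of x] show ?thesis unfolding phase_def norm_divide by simp
qed

text \<open>The numerator is a polynomial in \<open>cis x\<close>, and \<open>cis (k * x)\<close>
  extracts the \<open>k\<close>-th coefficient of the series for the denominator. What remains is
  the sum over \<open>k\<close> of
  \<open>(j choose k) * (- j gchoose k) * r ^ (2 * k)\<close>.\<close>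

lemma integral_phase_power:
  assumes r: "0 \<le> r" "r < 1" and j: "j \<ge> 1"
  shows "(\<integral>x. Re (phase r x ^ j) \<partial>circle) = jacobi_poly j (r\<^sup>2)"
proof -
  let ?a = "\<lambda>m. - of_nat j gchoose m :: complex"
  let ?g = "\<lambda>k x. cis (real k * x) * suminf (\<lambda>m. ?a m * (of_real r * cis (- x)) ^ m)"
  have sm: "summable (\<lambda>m. norm (?a m * of_real r ^ m))"
    using r by (intro inverse_power_binomial_series(2)) auto
  note int = integral_cis_power_series_circle[OF r(1) sm]
  have expand: "phase r x ^ j = (\<Sum>k\<le>j. of_nat (j choose k) * of_real r ^ k * ?g k x)" for x
  proof -
    have "(1 + of_real r * cis x) ^ j = (\<Sum>k\<le>j. of_nat (j choose k) * of_real r ^ k * cis (real k * x))"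
      unfolding add.commute[of 1] binomial_ring power_mult_distrib Complex.DeMoivre by (simp add: mult.assoc)
    moreover have "suminf (\<lambda>m. ?a m * (of_real r * cis (- x)) ^ m) = 1 / (1 + of_real r * cis (- x)) ^ j"
      using r by (intro inverse_power_binomial_series(1)) (simp add: norm_mult)
    ultimately show ?thesis
      by (simp add: phase_def power_divide sum_divide_distrib)
  qed
  have "integrable circle (\<lambda>x. phase r x ^ j)"
    unfolding expand using int(1) by auto
  then have "(\<integral>x. Re (phase r x ^ j) \<partial>circle) = Re (\<integral>x. phase r x ^ j \<partial>circle)"
    by (rule integral_Re)
  also have "(\<integral>x. phase r x ^ j \<partial>circle) = (\<Sum>k\<le>j. of_nat (j choose k) * of_real r ^ k * (?a k * of_real r ^ k))"
    unfolding expand using int by (subst Bochner_Integration.integral_sum) auto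
  also have "\<dots> = of_real (jacobi_poly j (r\<^sup>2))"
    unfolding jacobi_poly_def of_real_sum gchoose_minus_of_nat[OF j]
    by (intro sum.cong refl) (simp add: power2_eq_square power_mult_distrib)
  finally show ?thesis by simp
qed

text \<open>By Vandermonde's identity the sum is the coefficient of \<open>x ^ j\<close> in
  \<open>(1 + x) ^ (- j) * (1 + x) ^ j = 1\<close>. This settles \<open>u = 1\<close>, where
  \<open>phase\<close> has no radius \<open>r < 1\<close>.\<close>

lemma jacobi_poly_1:
  assumes "j \<ge> 1"
  shows "jacobi_poly j 1 = 0"
proof -
  have "jacobi_poly j 1 = (\<Sum>k=0..j. (- real j gchoose k) * (real j gchoose (j - k)))"
    unfolding jacobi_poly_def atMost_atLeast0 gchoose_minus_of_nat[OF assms]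
    by (intro sum.cong refl) (simp add: binomial_gbinomial[symmetric] binomial_symmetric[symmetric])
  also have "\<dots> = (- real j + real j) gchoose j" by (rule gbinomial_Vandermonde)
  also have "\<dots> = 0" using assms by (cases j) simp_all
  finally show ?thesis .
qed

text \<open>Apply the logarithm series to \<open>cis (2 * x)\<close>: all its positive powers have
  mean 0, and \<open>norm (1 - cis (2 * x)) = 2 * \<bar>sin x\<bar>\<close>.\<close>

lemma integral_ln_abs_sin_circle:
  shows "AE x in circle. \<bar>sin x\<bar> > 0" and "integrable circle (\<lambda>x. ln \<bar>sin x\<bar>)"
    and "(\<integral>x. ln \<bar>sin x\<bar> \<partial>circle) = - ln 2"
proof -
  have meas: "(\<lambda>x. \<bar>sin x\<bar>) \<in> borel_measurable circle" by simp
  have fin: "(\<integral>\<^sup>+x. neg_log \<bar>sin x\<bar> \<partial>circle) < \<infinity>"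
  proof -
    obtain K where "K < \<infinity>" "\<And>s. \<bar>s\<bar> \<le> 2 * pi \<Longrightarrow> (\<integral>\<^sup>+x. neg_log \<bar>sin (x + s)\<bar> \<partial>circle) \<le> K"
      using nn_integral_neg_log_sin_shift by blast
    from this(1) this(2)[of 0] show ?thesis by (simp add: order.strict_trans1)
  qed
  show pos: "AE x in circle. \<bar>sin x\<bar> > 0" and int: "integrable circle (\<lambda>x. ln \<bar>sin x\<bar>)"
    using circle.integrable_ln_if_neg_log[OF meas fin, of 1] by auto
  let ?z = "\<lambda>x. cis (2 * x)"
  have n: "norm (1 - ?z x) = 2 * \<bar>sin x\<bar>" for x
  proof -
    have "1 - ?z x = cis x * (cis (- x) - cis x)" by (simp add: algebra_simps cis_mult)
    also have "cis (- x) - cis x = - 2 * \<i> * of_real (sin x)" by (simp add: complex_eq_iff)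
    finally show ?thesis by (simp add: norm_mult)
  qed
  have ln: "AE x in circle. ln (norm (1 - ?z x)) = ln 2 + ln \<bar>sin x\<bar>"
    using pos by eventually_elim (simp add: n ln_mult)
  have "integrable circle (\<lambda>x. ln (norm (1 - ?z x)))"
    using ln int by (subst integrable_cong_AE[OF _ _ ln]) auto
  moreover have "AE x in circle. norm (?z x) \<le> 1 \<and> ?z x \<noteq> 1"
    using pos
  proof eventually_elim
    case (elim x)
    then have "norm (1 - ?z x) \<noteq> 0" unfolding n by simp
    then show ?case by auto
  qed
  ultimately have "(\<lambda>J. \<Sum>i<J. (\<integral>x. Re (?z x ^ Suc i) \<partial>circle) / real (Suc i)) \<longlonglongrightarrow> - (\<integral>x. ln (norm (1 - ?z x)) \<partial>circle)"
    by (intro circle.log_series_integral) auto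
  moreover have "(\<integral>x. Re (?z x ^ Suc i) \<partial>circle) = 0" for i
  proof -
    have "?z x ^ Suc i = cis (of_int (2 * int (Suc i)) * x)" for x
      unfolding Complex.DeMoivre by (simp add: algebra_simps)
    then show ?thesis
      using integral_cis_circle[of "2 * int (Suc i)"] integral_Re[of circle "\<lambda>x. cis (of_int (2 * int (Suc i)) * x)"]
      by (simp only: integrable_cis_circle) simp
  qed
  ultimately have "(\<integral>x. ln (norm (1 - ?z x)) \<partial>circle) = 0"
    by (simp add: LIMSEQ_const_iff del: power_Suc of_nat_Suc)
  also have "(\<integral>x. ln (norm (1 - ?z x)) \<partial>circle) = (\<integral>x. ln 2 + ln \<bar>sin x\<bar> \<partial>circle)"
    using ln by (intro integral_cong_AE) auto
  also have "\<dots> = ln 2 + (\<integral>x. ln \<bar>sin x\<bar> \<partial>circle)"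
    using int circle.prob_space by simp
  finally show "(\<integral>x. ln \<bar>sin x\<bar> \<partial>circle) = - ln 2" by simp
qed

text \<open>A case of Jensen's formula for a linear polynomial without zeros in the closed disc,
  obtained from the logarithm series at \<open>- r * cis x\<close>, whose positive powers have mean
  0.\<close>

lemma integral_ln_one_plus_cis_circle:
  assumes r: "0 \<le> r" "r < 1"
  shows "integrable circle (\<lambda>x. ln (norm (1 + of_real r * cis x)))"
    and "(\<integral>x. ln (norm (1 + of_real r * cis x)) \<partial>circle) = 0"
proof -
  let ?z = "\<lambda>x. - (of_real r * cis x)"
  have nz: "norm (?z x) = r" for x using r by (simp add: norm_mult)
  show int: "integrable circle (\<lambda>x. ln (norm (1 + of_real r * cis x)))"
  proof (rule circle.integrable_const_bound[where B = "max (ln 2) (- ln (1 - r))"])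
    show "AE x in circle. norm (ln (norm (1 + of_real r * cis x))) \<le> max (ln 2) (- ln (1 - r))"
    proof (rule AE_I2)
      fix x
      have "1 - r \<le> norm (1 + of_real r * cis x)" "norm (1 + of_real r * cis x) \<le> 2"
        using norm_triangle_ineq2[of 1 "?z x"] norm_triangle_ineq4[of 1 "?z x"] nz[of x] r by auto
      moreover from this have "ln (1 - r) \<le> ln (norm (1 + of_real r * cis x))"
        "ln (norm (1 + of_real r * cis x)) \<le> ln 2"
        using r one_plus_cis_neq_0[OF r] by (simp_all del: ln_le_cancel_iff add: ln_mono)
      ultimately show "norm (ln (norm (1 + of_real r * cis x))) \<le> max (ln 2) (- ln (1 - r))"
        by (simp add: abs_if max_def split: if_splits)
    qed
  qed simp
  have "AE x in circle. norm (?z x) \<le> 1 \<and> ?z x \<noteq> 1"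
  proof (rule AE_I2)
    fix x show "norm (?z x) \<le> 1 \<and> ?z x \<noteq> 1"
      using nz[of x] r by (metis less_imp_le less_irrefl norm_one)
  qed
  then have "(\<lambda>J. \<Sum>i<J. (\<integral>x. Re (?z x ^ Suc i) \<partial>circle) / real (Suc i)) \<longlonglongrightarrow> - (\<integral>x. ln (norm (1 - ?z x)) \<partial>circle)"
    using int by (intro circle.log_series_integral) auto
  moreover have "(\<integral>x. Re (?z x ^ Suc i) \<partial>circle) = 0" for i
  proof -
    have "?z x ^ Suc i = of_real (- r) ^ Suc i * cis (of_int (int (Suc i)) * x)" for x
    proof -
      have "?z x = of_real (- r) * cis x" by simp
      then show ?thesis by (simp only: power_mult_distrib Complex.DeMoivre of_int_of_nat_eq)
    qed
    moreover have "(\<integral>x. of_real (- r) ^ Suc i * cis (of_int (int (Suc i)) * x) \<partial>circle) = 0"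
      using integral_cis_circle[of "int (Suc i)"] by (simp only: integral_mult_right_zero) simp
    ultimately show ?thesis
      using integral_Re[of circle "\<lambda>x. of_real (- r) ^ Suc i * cis (of_int (int (Suc i)) * x)"]
      by (simp only: integrable_cis_circle integrable_mult_right) simp
  qed
  ultimately show "(\<integral>x. ln (norm (1 + of_real r * cis x)) \<partial>circle) = 0"
    by (simp add: LIMSEQ_const_iff del: power_Suc of_nat_Suc)
qed

text \<open>Here \<open>norm (1 - phase r x) = 2 * r * \<bar>sin x\<bar> / norm (1 + r * cis
  x)\<close>. By the two preceding integrals the mean of its logarithm is
  \<open>ln 2 + ln r - ln 2 - 0 = ln r\<close>.\<close>

lemma jacobi_poly_square_log_series:
  assumes r: "0 < r" "r < 1"
  shows "(\<lambda>J. \<Sum>i<J. jacobi_poly (Suc i) (r\<^sup>2) / real (Suc i)) \<longlonglongrightarrow> - ln r"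
    and "\<bar>\<Sum>i<J. jacobi_poly (Suc i) (r\<^sup>2) / real (Suc i)\<bar> \<le> 5 - ln r"
proof -
  have r': "0 \<le> r" "r < 1" using r by auto
  have [measurable]: "phase r \<in> borel_measurable borel" by (rule measurable_phase[OF r'])
  have n: "norm (1 - phase r x) = 2 * r * \<bar>sin x\<bar> / norm (1 + of_real r * cis x)" for x
  proof -
    have "1 - phase r x = (of_real r * (cis (- x) - cis x)) / (1 + of_real r * cis (- x))"
      using one_plus_cis_neq_0[OF r', of "- x"] by (simp add: phase_def field_simps)
    also have "cis (- x) - cis x = - 2 * \<i> * of_real (sin x)" by (simp add: complex_eq_iff)
    also have "1 + of_real r * cis (- x) = cnj (1 + of_real r * cis x)" by (simp add: cis_cnj)
    finally show ?thesis using r by (simp only: norm_divide norm_mult complex_mod_cnj) simp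
  qed
  have ln: "AE x in circle. ln (norm (1 - phase r x)) = ln 2 + ln r + ln \<bar>sin x\<bar> - ln (norm (1 + of_real r * cis x))"
    using integral_ln_abs_sin_circle(1)
    by eventually_elim (use r one_plus_cis_neq_0[OF r'] in \<open>simp add: n ln_mult ln_div\<close>)
  note ints = integral_ln_abs_sin_circle(2) integral_ln_one_plus_cis_circle(1)[OF r']
  have int: "integrable circle (\<lambda>x. ln (norm (1 - phase r x)))"
    using ints by (subst integrable_cong_AE[OF _ _ ln]) auto
  have val: "(\<integral>x. ln (norm (1 - phase r x)) \<partial>circle) = ln r"
  proof -
    have "(\<integral>x. ln (norm (1 - phase r x)) \<partial>circle)
       = (\<integral>x. ln 2 + ln r + ln \<bar>sin x\<bar> - ln (norm (1 + of_real r * cis x)) \<partial>circle)"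
      using ln by (intro integral_cong_AE) auto
    then show ?thesis
      using ints integral_ln_abs_sin_circle(3) integral_ln_one_plus_cis_circle(2)[OF r'] circle.prob_space
      by simp
  qed
  have ae: "AE x in circle. norm (phase r x) \<le> 1 \<and> phase r x \<noteq> 1"
    using integral_ln_abs_sin_circle(1)
  proof eventually_elim
    case (elim x)
    then have "norm (1 - phase r x) > 0" unfolding n using r one_plus_cis_neq_0[OF r', of x] by simp
    then show ?case using norm_phase[OF r', of x] by auto
  qed
  note L = circle.log_series_integral[OF _ ae int, unfolded val]
  have e: "(\<integral>x. Re (phase r x ^ Suc i) \<partial>circle) = jacobi_poly (Suc i) (r\<^sup>2)" for i
    by (rule integral_phase_power[OF r']) simp
  show "(\<lambda>J. \<Sum>i<J. jacobi_poly (Suc i) (r\<^sup>2) / real (Suc i)) \<longlonglongrightarrow> - ln r"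
    and "\<bar>\<Sum>i<J. jacobi_poly (Suc i) (r\<^sup>2) / real (Suc i)\<bar> \<le> 5 - ln r"
    using L unfolding e by auto
qed

text \<open>Twice the previous result at \<open>r = sqrt u\<close>; at \<open>u = 1\<close> every
  term vanishes by \<open>jacobi_poly_1\<close>.\<close>

lemma jacobi_poly_log_series:
  assumes u: "0 < u" "u \<le> 1"
  shows "(\<lambda>J. \<Sum>i<J. 2 / real (Suc i) * jacobi_poly (Suc i) u) \<longlonglongrightarrow> - ln u"
    and "\<bar>\<Sum>i<J. 2 / real (Suc i) * jacobi_poly (Suc i) u\<bar> \<le> 10 - ln u"
proof -
  have eq: "(\<Sum>i<J. 2 / real (Suc i) * jacobi_poly (Suc i) u) = 2 * (\<Sum>i<J. jacobi_poly (Suc i) ((sqrt u)\<^sup>2) / real (Suc i))" for J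
    using u by (simp add: sum_distrib_left)
  consider "u = 1" | "u < 1" using u by linarith
  then have "(\<lambda>J. \<Sum>i<J. 2 / real (Suc i) * jacobi_poly (Suc i) u) \<longlonglongrightarrow> - ln u \<and>
    \<bar>\<Sum>i<J. 2 / real (Suc i) * jacobi_poly (Suc i) u\<bar> \<le> 10 - ln u"
  proof cases
    case 1
    then show ?thesis by (simp add: jacobi_poly_1)
  next
    case 2
    have r: "0 < sqrt u" "sqrt u < 1" using u 2 by auto
    have "2 * ln (sqrt u) = ln u" using u by (simp add: ln_sqrt)
    with tendsto_mult_left[OF jacobi_poly_square_log_series(1)[OF r], of 2] jacobi_poly_square_log_series(2)[OF r, of J]
    show ?thesis unfolding eq by (simp add: abs_mult del: of_nat_Suc)
  qed
  then show "(\<lambda>J. \<Sum>i<J. 2 / real (Suc i) * jacobi_poly (Suc i) u) \<longlonglongrightarrow> - ln u"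
    and "\<bar>\<Sum>i<J. 2 / real (Suc i) * jacobi_poly (Suc i) u\<bar> \<le> 10 - ln u" by auto
qed

subsection \<open>Moments of a linear form on the torus\<close>

text \<open>The index set of \<open>a_coeff\<close>, for an arbitrary set of indices so that the
  multinomial theorem can be proved by induction on that set.\<close>

definition compositions :: "'i set \<Rightarrow> nat \<Rightarrow> ('i \<Rightarrow> nat) set" where
  "compositions A k = {l \<in> A \<rightarrow>\<^sub>E UNIV. (\<Sum>m\<in>A. l m) = k}"

lemma finite_compositions_set:
  assumes "finite A"
  shows "finite (compositions A k)"
proof (rule finite_subset)
  have "l i \<le> (\<Sum>m\<in>A. l m)" if "i \<in> A" for l :: "'a \<Rightarrow> nat" and i
    using that assms by (intro member_le_sum) auto
  then show "compositions A k \<subseteq> A \<rightarrow>\<^sub>E {..k}"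
    by (auto simp: PiE_def compositions_def)
qed (use assms in \<open>auto intro: finite_PiE\<close>)

lemma sum_compositions_insert:
  assumes "finite A" "a \<notin> A"
  shows "(\<Sum>l\<in>compositions (insert a A) k. f l) = (\<Sum>j\<le>k. \<Sum>l\<in>compositions A (k - j). f (l(a := j)))"
proof -
  have s: "(\<Sum>m\<in>A. (l(a := j)) m) = (\<Sum>m\<in>A. l m)" for l :: "'a \<Rightarrow> nat" and j
    using assms by (intro sum.cong) auto
  have "(\<Sum>j\<le>k. \<Sum>l\<in>compositions A (k - j). f (l(a := j)))
      = (\<Sum>(j, l)\<in>(SIGMA j:{..k}. compositions A (k - j)). f (l(a := j)))"
    using assms by (subst sum.Sigma) (auto intro: finite_compositions_set)
  also have "\<dots> = (\<Sum>l\<in>compositions (insert a A) k. f l)"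
  \<comment> \<open>Removing \<open>a\<close> resets its value to \<open>undefined\<close>, as
    functions in \<open>compositions A\<close> are extensional.\<close>
  proof (rule sum.reindex_bij_witness[where i = "\<lambda>l. (l a, l(a := undefined))" and j = "\<lambda>(j, l). l(a := j)"])
    fix p assume p: "p \<in> (SIGMA j:{..k}. compositions A (k - j))"
    obtain j l where jl: "p = (j, l)" by (cases p)
    with p have *: "j \<le> k" "l \<in> A \<rightarrow>\<^sub>E UNIV" "(\<Sum>m\<in>A. l m) = k - j" by (auto simp: compositions_def)
    have "l a = undefined" using *(2) assms(2) by (rule PiE_arb)
    then show "(\<lambda>l. (l a, l(a := undefined))) (case p of (j, l) \<Rightarrow> l(a := j)) = p"
      by (auto simp: jl fun_eq_iff)
    have "l(a := j) \<in> insert a A \<rightarrow>\<^sub>E UNIV" using *(2) by (auto simp: PiE_def extensional_def)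
    moreover have "(\<Sum>m\<in>insert a A. (l(a := j)) m) = k"
      using assms *(1) by (subst sum.insert) (simp_all add: s *(3) del: fun_upd_apply, simp)
    ultimately show "(case p of (j, l) \<Rightarrow> l(a := j)) \<in> compositions (insert a A) k"
      unfolding jl compositions_def prod.case by blast
  next
    fix l assume "l \<in> compositions (insert a A) k"
    then have *: "l \<in> insert a A \<rightarrow>\<^sub>E UNIV" "l a + (\<Sum>m\<in>A. l m) = k"
      using assms by (auto simp: compositions_def)
    have "l(a := undefined) \<in> A \<rightarrow>\<^sub>E UNIV" using *(1) assms(2) by (auto simp: PiE_def extensional_def)
    moreover have "(\<Sum>m\<in>A. (l(a := undefined)) m) = k - l a" unfolding s using *(2) by simp
    ultimately show "(l a, l(a := undefined)) \<in> (SIGMA j:{..k}. compositions A (k - j))"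
      using *(2) unfolding compositions_def by auto
  qed (auto split: prod.splits)
  finally show ?thesis ..
qed

text \<open>The binomial theorem splits off the variable at the new index, and
  \<open>(k choose j) * fact (k - j) = fact k / fact j\<close> merges the coefficients.\<close>

lemma multinomial_theorem:
  fixes x :: "'i \<Rightarrow> 'a::field_char_0"
  assumes "finite A"
  shows "(\<Sum>m\<in>A. x m) ^ k = (\<Sum>l\<in>compositions A k. fact k / (\<Prod>m\<in>A. fact (l m)) * (\<Prod>m\<in>A. x m ^ l m))"
  using assms
proof (induction A arbitrary: k rule: finite_induct)
  case empty
  \<comment> \<open>The only extensional function on the empty set has sum 0, which matches
    \<open>0 ^ k\<close>.\<close>
  have "compositions ({} :: 'i set) k = (if k = 0 then {\<lambda>_. undefined} else {})"
    by (auto simp: compositions_def)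
  then show ?case by (simp add: power_0_left)
next
  case (insert a A)
  have "(\<Sum>m\<in>insert a A. x m) ^ k = (\<Sum>j\<le>k. of_nat (k choose j) * x a ^ j * (\<Sum>m\<in>A. x m) ^ (k - j))"
    using insert.hyps by (simp add: binomial_ring)
  also have "\<dots> = (\<Sum>j\<le>k. \<Sum>l\<in>compositions A (k - j).
      fact k / (\<Prod>m\<in>insert a A. fact ((l(a := j)) m)) * (\<Prod>m\<in>insert a A. x m ^ (l(a := j)) m))"
  proof (rule sum.cong[OF refl])
    fix j assume j: "j \<in> {..k}"
    have "of_nat (k choose j) * x a ^ j * (\<Sum>m\<in>A. x m) ^ (k - j) = (\<Sum>l\<in>compositions A (k - j).
        (of_nat (k choose j) * fact (k - j)) * x a ^ j / (\<Prod>m\<in>A. fact (l m)) * (\<Prod>m\<in>A. x m ^ l m))"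
      unfolding insert.IH sum_distrib_left by (intro sum.cong refl) (simp only: divide_inverse mult_ac)
    also have "of_nat (k choose j) * fact (k - j) = (fact k / fact j :: 'a)"
      using j by (simp add: binomial_fact)
    also have "(\<Sum>l\<in>compositions A (k - j). fact k / fact j * x a ^ j / (\<Prod>m\<in>A. fact (l m)) * (\<Prod>m\<in>A. x m ^ l m))
      = (\<Sum>l\<in>compositions A (k - j).
        fact k / (\<Prod>m\<in>insert a A. fact ((l(a := j)) m)) * (\<Prod>m\<in>insert a A. x m ^ (l(a := j)) m))"
    proof (rule sum.cong[OF refl])
      fix l
      have "(\<Prod>m\<in>A. fact ((l(a := j)) m)) = (\<Prod>m\<in>A. fact (l m) :: 'a)"
        "(\<Prod>m\<in>A. x m ^ (l(a := j)) m) = (\<Prod>m\<in>A. x m ^ l m)"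
        using insert.hyps by (auto intro!: prod.cong)
      then show "fact k / fact j * x a ^ j / (\<Prod>m\<in>A. fact (l m)) * (\<Prod>m\<in>A. x m ^ l m)
        = fact k / (\<Prod>m\<in>insert a A. fact ((l(a := j)) m)) * (\<Prod>m\<in>insert a A. x m ^ (l(a := j)) m)"
        using insert.hyps by (simp add: divide_inverse mult_ac del: fun_upd_apply) simp
    qed
    finally show "of_nat (k choose j) * x a ^ j * (\<Sum>m\<in>A. x m) ^ (k - j) = (\<Sum>l\<in>compositions A (k - j).
        fact k / (\<Prod>m\<in>insert a A. fact ((l(a := j)) m)) * (\<Prod>m\<in>insert a A. x m ^ (l(a := j)) m))" .
  qed
  also have "\<dots> = (\<Sum>l\<in>compositions (insert a A) k.
      fact k / (\<Prod>m\<in>insert a A. fact (l m)) * (\<Prod>m\<in>insert a A. x m ^ l m))"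
    using insert.hyps by (rule sum_compositions_insert[symmetric])
  finally show ?case .
qed

section \<open>The uniform probability measure on the torus\<close>

abbreviation torus :: "'i set \<Rightarrow> ('i \<Rightarrow> real) measure" where
  "torus I \<equiv> \<Pi>\<^sub>M i\<in>I. circle"

interpretation circles: product_sigma_finite "\<lambda>_. circle"
  by standard

lemma prob_space_torus: "prob_space (torus I)"
  by (intro prob_space_PiM prob_space_circle)

text \<open>Both measures agree on boxes. This links products of \<open>circle\<close>, convenient
  for Fubini, with the Lebesgue integral in \<open>log_mahler_measure\<close>.\<close>

lemma torus_eq_uniform_measure:
  assumes I: "finite I"
  shows "torus I = uniform_measure (\<Pi>\<^sub>M i\<in>I. lborel) (\<Pi>\<^sub>E i\<in>I. {0..2 * pi})"
proof (rule circles.PiM_eqI[OF I, symmetric])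
  interpret L: product_sigma_finite "\<lambda>_::'a. lborel :: real measure" by standard
  show "sets (uniform_measure (\<Pi>\<^sub>M i\<in>I. lborel) (\<Pi>\<^sub>E i\<in>I. {0..2 * pi})) = sets (torus I)"
    by (auto intro!: sets_PiM_cong)
  fix A :: "'a \<Rightarrow> real set" assume "\<And>i. i \<in> I \<Longrightarrow> A i \<in> sets circle"
  then have A: "\<And>i. i \<in> I \<Longrightarrow> A i \<in> sets borel" by simp
  let ?B = "\<Pi>\<^sub>E i\<in>I. {0..2 * pi}"
  have "emeasure (uniform_measure (\<Pi>\<^sub>M i\<in>I. lborel) ?B) (Pi\<^sub>E I A)
      = emeasure (\<Pi>\<^sub>M i\<in>I. lborel) (?B \<inter> Pi\<^sub>E I A) / emeasure (\<Pi>\<^sub>M i\<in>I. lborel) ?B"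
    using I A by (intro emeasure_uniform_measure sets_PiM_I_finite) auto
  also have "?B \<inter> Pi\<^sub>E I A = (\<Pi>\<^sub>E i\<in>I. {0..2 * pi} \<inter> A i)" by (rule PiE_Int)
  also have "emeasure (\<Pi>\<^sub>M i\<in>I. lborel) (\<Pi>\<^sub>E i\<in>I. {0..2 * pi} \<inter> A i) = (\<Prod>i\<in>I. emeasure lborel ({0..2 * pi} \<inter> A i))"
    using I A by (intro L.emeasure_PiM) auto
  also have "emeasure (\<Pi>\<^sub>M i\<in>I. lborel) ?B = (\<Prod>i\<in>I. emeasure lborel {0..2 * pi :: real})"
    using I by (intro L.emeasure_PiM) auto
  also have "(\<Prod>i\<in>I. emeasure lborel ({0..2 * pi} \<inter> A i)) / (\<Prod>i\<in>I. emeasure lborel {0..2 * pi :: real})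
      = (\<Prod>i\<in>I. emeasure lborel ({0..2 * pi} \<inter> A i) / emeasure lborel {0..2 * pi :: real})"
    by (simp only: divide_ennreal_def prod.distrib prod_constant ennreal_inverse_power)
  also have "\<dots> = (\<Prod>i\<in>I. emeasure circle (A i))"
    using A unfolding circle_def by (intro prod.cong refl emeasure_uniform_measure[symmetric]) auto
  finally show "emeasure (uniform_measure (\<Pi>\<^sub>M i\<in>I. lborel) ?B) (Pi\<^sub>E I A) = (\<Prod>i\<in>I. emeasure circle (A i))" .
qed

lemma integral_torus:
  fixes f :: "('i \<Rightarrow> real) \<Rightarrow> 'b::{banach, second_countable_topology}"
  assumes I: "finite I" and [measurable]: "f \<in> borel_measurable (torus I)"
  shows "(\<integral>x. f x \<partial>torus I) = (LINT x:(\<Pi>\<^sub>E i\<in>I. {0..2 * pi})|(\<Pi>\<^sub>M i\<in>I. lborel). f x) /\<^sub>R (2 * pi) ^ card I"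
proof -
  interpret L: product_sigma_finite "\<lambda>_::'i. lborel :: real measure" by standard
  have sets: "sets (torus I) = sets (\<Pi>\<^sub>M i\<in>I. lborel)" by (auto intro!: sets_PiM_cong)
  have f: "f \<in> borel_measurable (\<Pi>\<^sub>M i\<in>I. lborel)"
    using assms(2) measurable_cong_sets[OF sets refl] by blast
  have "emeasure (\<Pi>\<^sub>M i\<in>I. lborel) (\<Pi>\<^sub>E i\<in>I. {0..2 * pi}) = (\<Prod>i\<in>I. emeasure lborel {0..2 * pi :: real})"
    using I by (intro L.emeasure_PiM) auto
  also have "\<dots> = ennreal ((2 * pi) ^ card I)" by (simp add: ennreal_power)
  finally have e: "emeasure (\<Pi>\<^sub>M i\<in>I. lborel) (\<Pi>\<^sub>E i\<in>I. {0..2 * pi}) = ennreal ((2 * pi) ^ card I)" .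
  then have m: "measure (\<Pi>\<^sub>M i\<in>I. lborel) (\<Pi>\<^sub>E i\<in>I. {0..2 * pi}) = (2 * pi) ^ card I"
    by (simp add: measure_def)
  show ?thesis
    unfolding torus_eq_uniform_measure[OF I]
    using I f e m by (subst integral_uniform_measure) (auto intro!: sets_PiM_I_finite)
qed

section \<open>Even moments of the modulus of a linear form\<close>

definition torus_form :: "'i set \<Rightarrow> ('i \<Rightarrow> complex) \<Rightarrow> ('i \<Rightarrow> real) \<Rightarrow> complex" where
  "torus_form I D t = (\<Sum>m\<in>I. D m * cis (t m))"

lemma measurable_torus_form [measurable]: "torus_form I D \<in> borel_measurable (torus I)"
  unfolding torus_form_def by measurable

lemma integral_character_torus:
  assumes I: "finite I"
  shows "integrable (torus I) (\<lambda>t. \<Prod>m\<in>I. cis (of_int (e m) * t m))"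
    and "(\<integral>t. (\<Prod>m\<in>I. cis (of_int (e m) * t m)) \<partial>torus I) = (if \<forall>m\<in>I. e m = 0 then 1 else 0)"
proof -
  show "integrable (torus I) (\<lambda>t. \<Prod>m\<in>I. cis (of_int (e m) * t m))"
    by (rule circles.product_integrable_prod[OF I]) simp
  have "(\<integral>t. (\<Prod>m\<in>I. cis (of_int (e m) * t m)) \<partial>torus I) = (\<Prod>m\<in>I. \<integral>x. cis (of_int (e m) * x) \<partial>circle)"
    by (rule circles.product_integral_prod[OF I]) simp
  also have "\<dots> = (if \<forall>m\<in>I. e m = 0 then 1 else 0)"
    unfolding integral_cis_circle using I by auto
  finally show "(\<integral>t. (\<Prod>m\<in>I. cis (of_int (e m) * t m)) \<partial>torus I) = (if \<forall>m\<in>I. e m = 0 then 1 else 0)" .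
qed

text \<open>Expand \<open>X ^ k * cnj (X ^ k)\<close> by the multinomial theorem into a double sum
  over compositions; orthogonality of characters leaves the diagonal, which squares the multinomial
  coefficients.\<close>

lemma torus_form_moment:
  assumes I: "finite I"
  shows "integrable (torus I) (\<lambda>t. norm (torus_form I D t) ^ (2 * k))"
    and "(\<integral>t. norm (torus_form I D t) ^ (2 * k) \<partial>torus I)
      = (\<Sum>l\<in>compositions I k. (fact k / (\<Prod>m\<in>I. fact (l m)))\<^sup>2 * (\<Prod>m\<in>I. norm (D m) ^ (2 * l m)))"
proof -
  define c :: "('a \<Rightarrow> nat) \<Rightarrow> complex" where "c l = fact k / (\<Prod>m\<in>I. fact (l m))" for l
  define w where "w l l' = c l * c l' * (\<Prod>m\<in>I. D m ^ l m * cnj (D m) ^ l' m)" for l l'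
  define g where "g l l' t = w l l' * (\<Prod>m\<in>I. cis (of_int (int (l m) - int (l' m)) * t m))" for l l' t
  have cnj_c: "cnj (c l) = c l" for l by (simp add: c_def)
  have pw: "torus_form I D t ^ k = (\<Sum>l\<in>compositions I k. c l * (\<Prod>m\<in>I. (D m * cis (t m)) ^ l m))" for t
    unfolding torus_form_def c_def by (rule multinomial_theorem[OF I])
  have g: "c l * (\<Prod>m\<in>I. (D m * cis (t m)) ^ l m) * cnj (c l' * (\<Prod>m\<in>I. (D m * cis (t m)) ^ l' m)) = g l l' t" for l l' t
  proof -
    have "(D m * cis (t m)) ^ l m * cnj ((D m * cis (t m)) ^ l' m)
      = D m ^ l m * cnj (D m) ^ l' m * cis (of_int (int (l m) - int (l' m)) * t m)" for m
    proof -
      have "cis (real (l m) * t m) * cis (real (l' m) * - t m) = cis (of_int (int (l m) - int (l' m)) * t m)"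
        unfolding cis_mult by (simp add: left_diff_distrib)
      then have "D m ^ l m * cnj (D m) ^ l' m * (cis (real (l m) * t m) * cis (real (l' m) * - t m))
        = D m ^ l m * cnj (D m) ^ l' m * cis (of_int (int (l m) - int (l' m)) * t m)"
        by (simp only:)
      then show ?thesis
        unfolding complex_cnj_power complex_cnj_mult cis_cnj power_mult_distrib Complex.DeMoivre
        by (simp only: mult_ac mult_minus_left mult_minus_right)
    qed
    then have "(\<Prod>m\<in>I. (D m * cis (t m)) ^ l m) * cnj (\<Prod>m\<in>I. (D m * cis (t m)) ^ l' m)
      = (\<Prod>m\<in>I. D m ^ l m * cnj (D m) ^ l' m) * (\<Prod>m\<in>I. cis (of_int (int (l m) - int (l' m)) * t m))"
      unfolding cnj_prod prod.distrib[symmetric] by (intro prod.cong refl)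
    then show ?thesis
      unfolding g_def w_def complex_cnj_mult cnj_c by (simp only: mult_ac)
  qed
  have expand: "of_real (norm (torus_form I D t) ^ (2 * k)) = (\<Sum>l\<in>compositions I k. \<Sum>l'\<in>compositions I k. g l l' t)" for t
  proof -
    have "of_real (norm (torus_form I D t) ^ (2 * k)) = torus_form I D t ^ k * cnj (torus_form I D t ^ k)"
      unfolding complex_norm_square[symmetric] by (simp add: power_mult[symmetric] norm_power mult.commute)
    then show ?thesis unfolding pw cnj_sum sum_product g .
  qed
  have int_g: "integrable (torus I) (g l l')" for l l'
    unfolding g_def by (intro integrable_mult_right integral_character_torus I)
  have val_g: "(\<integral>t. g l l' t \<partial>torus I) = (if l = l' then w l l else 0)"
    if "l \<in> compositions I k" "l' \<in> compositions I k" for l l'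
  proof -
    \<comment> \<open>Agreement on \<open>I\<close> means equality because compositions are
      extensional.\<close>
    have "(\<forall>m\<in>I. int (l m) - int (l' m) = 0) \<longleftrightarrow> l = l'"
      using that unfolding compositions_def by (auto intro: PiE_ext)
    then show ?thesis
      unfolding g_def integral_mult_right_zero integral_character_torus(2)[OF I] by simp
  qed
  have int: "integrable (torus I) (\<lambda>t. complex_of_real (norm (torus_form I D t) ^ (2 * k)))"
    unfolding expand using int_g by auto
  show "integrable (torus I) (\<lambda>t. norm (torus_form I D t) ^ (2 * k))"
    using integrable_Re[OF int] by (simp only: Re_complex_of_real)
  have "of_real (\<integral>t. norm (torus_form I D t) ^ (2 * k) \<partial>torus I)
    = (\<integral>t. complex_of_real (norm (torus_form I D t) ^ (2 * k)) \<partial>torus I)"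
    by (rule integral_complex_of_real[symmetric])
  also have "\<dots> = (\<Sum>l\<in>compositions I k. \<Sum>l'\<in>compositions I k. \<integral>t. g l l' t \<partial>torus I)"
    unfolding expand using int_g by (simp only: Bochner_Integration.integral_sum Bochner_Integration.integrable_sum)
  also have "\<dots> = (\<Sum>l\<in>compositions I k. \<Sum>l'\<in>compositions I k. if l = l' then w l l else 0)"
    by (intro sum.cong refl val_g)
  also have "\<dots> = (\<Sum>l\<in>compositions I k. w l l)"
    by (intro sum.cong refl) (simp add: sum.delta finite_compositions_set[OF I])
  also have "\<dots> = of_real (\<Sum>l\<in>compositions I k. (fact k / (\<Prod>m\<in>I. fact (l m)))\<^sup>2 * (\<Prod>m\<in>I. norm (D m) ^ (2 * l m)))"
    unfolding of_real_sum
  proof (intro sum.cong refl)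
    fix l
    have "D m ^ l m * cnj (D m) ^ l m = of_real (norm (D m) ^ (2 * l m))" for m
      by (simp only: power_mult_distrib[symmetric] complex_norm_square[symmetric] power_mult of_real_power)
    then show "w l l = of_real ((fact k / (\<Prod>m\<in>I. fact (l m)))\<^sup>2 * (\<Prod>m\<in>I. norm (D m) ^ (2 * l m)))"
      by (simp add: w_def c_def power2_eq_square)
  qed
  finally show "(\<integral>t. norm (torus_form I D t) ^ (2 * k) \<partial>torus I)
      = (\<Sum>l\<in>compositions I k. (fact k / (\<Prod>m\<in>I. fact (l m)))\<^sup>2 * (\<Prod>m\<in>I. norm (D m) ^ (2 * l m)))"
    by (simp only: of_real_eq_iff)
qed

section \<open>Integrability of the logarithm of a linear form\<close>

lemma norm_add_cis_ge:
  obtains s where "\<bar>s\<bar> \<le> 2 * pi" "\<And>y. norm w * \<bar>sin (y + s)\<bar> \<le> norm (z + w * cis y)"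
proof
  \<comment> \<open>Rotation by \<open>- Arg z\<close> makes \<open>z\<close> real, so that only the
    other summand contributes to the imaginary part, which bounds the norm from below.\<close>
  let ?s = "Arg w - Arg z"
  show "\<bar>?s\<bar> \<le> 2 * pi" using Arg_bounded[of w] Arg_bounded[of z] by (auto simp: abs_if)
  fix y
  have "z + w * cis y = cis (Arg z) * (of_real (norm z) + of_real (norm w) * cis (y + ?s))"
  proof -
    have "z + w * cis y = of_real (norm z) * cis (Arg z) + of_real (norm w) * (cis (Arg w) * cis y)"
      using rcis_cmod_Arg[of z] rcis_cmod_Arg[of w] by (simp add: rcis_def mult.assoc[symmetric])
    also have "cis (Arg w) * cis y = cis (Arg z) * cis (y + ?s)" by (simp add: cis_mult add.commute)
    finally show ?thesis
      by (simp add: algebra_simps)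
  qed
  then have "norm (z + w * cis y) = norm (of_real (norm z) + of_real (norm w) * cis (y + ?s))"
    by (simp add: norm_mult)
  moreover have "Im (of_real (norm z) + of_real (norm w) * cis (y + ?s)) = norm w * sin (y + ?s)" by simp
  ultimately show "norm w * \<bar>sin (y + ?s)\<bar> \<le> norm (z + w * cis y)"
    using abs_Im_le_cmod[of "of_real (norm z) + of_real (norm w) * cis (y + ?s)"] by (simp only: abs_mult abs_norm_cancel)
qed

text \<open>Integrate first over a coordinate \<open>a\<close> with non-zero coefficient. For fixed
  other coordinates the form dominates \<open>norm (D a)\<close> times a shifted sine, so the inner
  integral is bounded by a constant independent of them.\<close>

lemma nn_integral_neg_log_torus_form:
  assumes I: "finite I" and a: "a \<in> I" "D a \<noteq> 0"
  shows "(\<integral>\<^sup>+t. neg_log (norm (torus_form I D t)) \<partial>torus I) < \<infinity>"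
proof -
  obtain K where K: "K < \<infinity>" "\<And>s. \<bar>s\<bar> \<le> 2 * pi \<Longrightarrow> (\<integral>\<^sup>+x. neg_log \<bar>sin (x + s)\<bar> \<partial>circle) \<le> K"
    using nn_integral_neg_log_sin_shift by blast
  let ?C = "neg_log (norm (D a)) + K"
  define J where "J = I - {a}"
  have J: "finite J" "a \<notin> J" "I = insert a J" using I a by (auto simp: J_def)
  interpret P: prob_space "torus J" by (rule prob_space_torus)
  have "(\<integral>\<^sup>+t. neg_log (norm (torus_form I D t)) \<partial>torus I)
    = (\<integral>\<^sup>+t. \<integral>\<^sup>+y. neg_log (norm (torus_form I D (t(a := y)))) \<partial>circle \<partial>torus J)"
    unfolding J(3) using J(1,2) by (intro circles.product_nn_integral_insert) measurable
  also have "\<dots> \<le> (\<integral>\<^sup>+t. ?C \<partial>torus J)"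
  proof (rule nn_integral_mono)
    fix t
    have eq: "torus_form I D (t(a := y)) = torus_form J D t + D a * cis y" for y
      unfolding torus_form_def J(3) using J(1,2) by (simp add: add.commute) (intro sum.cong, auto)
    obtain s where s: "\<bar>s\<bar> \<le> 2 * pi" "\<And>y. norm (D a) * \<bar>sin (y + s)\<bar> \<le> norm (torus_form J D t + D a * cis y)"
      using norm_add_cis_ge[of "D a" "torus_form J D t"] by blast
    have "(\<integral>\<^sup>+y. neg_log (norm (torus_form I D (t(a := y)))) \<partial>circle)
      \<le> (\<integral>\<^sup>+y. neg_log (norm (D a)) + neg_log \<bar>sin (y + s)\<bar> \<partial>circle)"
      unfolding eq
      by (intro nn_integral_mono order_trans[OF neg_log_antimono[OF s(2)]] neg_log_mult_le)
    also have "\<dots> = neg_log (norm (D a)) + (\<integral>\<^sup>+y. neg_log \<bar>sin (y + s)\<bar> \<partial>circle)"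
      by (subst nn_integral_add) (auto simp: circle.emeasure_space_1[simplified])
    also have "\<dots> \<le> ?C" using K(2)[OF s(1)] by (rule add_left_mono)
    finally show "(\<integral>\<^sup>+y. neg_log (norm (torus_form I D (t(a := y)))) \<partial>circle) \<le> ?C" .
  qed
  also have "\<dots> = ?C" by (simp add: P.emeasure_space_1)
  also have "\<dots> < \<infinity>" using K(1) neg_log_finite[of "norm (D a)"] a by simp
  finally show ?thesis .
qed

section \<open>Term-by-term integration over the torus and the Mahler measure\<close>

lemma a_coeff_eq_moment:
  "a_coeff n k D = (\<integral>t. norm (torus_form {..n} D t) ^ (2 * k) \<partial>torus {..n})"
  unfolding a_coeff_def torus_form_moment(2)[OF finite_atMost] multinomial_def compositions_def by simp

lemma normD_pos:
  assumes "\<exists>m\<le>n. D m \<noteq> 0"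
  shows "(normD n D)\<^sup>2 > 0"
proof -
  obtain m where "m \<le> n" "D m \<noteq> 0" using assms by blast
  then have "0 < (\<Sum>m\<le>n. (norm (D m))\<^sup>2)"
    by (intro sum_pos2[of _ m]) auto
  then show ?thesis by (simp add: normD_def)
qed

text \<open>Cauchy-Schwarz against the all-ones vector, which is the source of the factor
  \<open>n + 1\<close> in \<open>c_const\<close>.\<close>

lemma norm_torus_form_le: "(norm (torus_form {..n} D t))\<^sup>2 \<le> (c_const n D)\<^sup>2"
proof -
  have "norm (torus_form {..n} D t) \<le> (\<Sum>m\<le>n. 1 * norm (D m))"
    unfolding torus_form_def by (intro sum_norm_le) (simp add: norm_mult)
  then have "(norm (torus_form {..n} D t))\<^sup>2 \<le> (\<Sum>m\<le>n. 1 * norm (D m))\<^sup>2"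
    by (intro power_mono) auto
  also have "\<dots> \<le> (\<Sum>m\<le>n. 1\<^sup>2) * (\<Sum>m\<le>n. (norm (D m))\<^sup>2)"
    by (rule Cauchy_Schwarz_ineq_sum)
  also have "\<dots> = (c_const n D)\<^sup>2"
    by (simp add: c_const_def normD_def sum_nonneg)
  finally show ?thesis .
qed

text \<open>Summability is part of the claim because \<open>suminf\<close> of a divergent series is
  an unspecified number.\<close>

theorem mainTheorem3:
  fixes n :: nat and D :: "nat \<Rightarrow> complex"
  assumes "n \<ge> 3"
    and "\<exists>m\<le>n. D m \<noteq> 0"
  shows "summable (\<lambda>i. S_term n D (Suc i)) \<and>
    log_mahler_measure (n + 1) (linear_form n D) = ln (c_const n D) - 1 / 2 * S0 n D"
proof -
  let ?T = "torus {..n}" and ?X = "torus_form {..n} D"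
  define c where "c = c_const n D"
  define u where "u t = (norm (?X t))\<^sup>2 / c\<^sup>2" for t
  interpret P: prob_space ?T by (rule prob_space_torus)
  have c: "c > 0" using normD_pos[of n D] assms(2) by (simp add: c_def c_const_def)
  have [measurable]: "u \<in> borel_measurable ?T" unfolding u_def by measurable
  have u_le: "u t \<le> 1" for t
    using norm_torus_form_le[of n D t] c by (simp add: u_def c_def)
  have X_le: "norm (?X t) \<le> c" for t
    using norm_torus_form_le[of n D t] c by (auto simp: c_def intro: power2_le_imp_le)
  obtain a where a: "a \<in> {..n}" "D a \<noteq> 0" using assms(2) by auto
  have X_pos: "AE t in ?T. norm (?X t) > 0" and int_ln_X: "integrable ?T (\<lambda>t. ln (norm (?X t)))"
    using P.integrable_ln_if_neg_log[of "\<lambda>t. norm (?X t)" c, OF _ nn_integral_neg_log_torus_form[where D = D, OF finite_atMost a]] X_le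
    by auto
  \<comment> \<open>The expansion of \<open>- ln u\<close> is available only for positive
    \<open>u\<close>; the zeros of the form are a null set.\<close>
  have ln_u: "AE t in ?T. 0 < u t \<and> ln (u t) = 2 * ln (norm (?X t)) - 2 * ln c"
    using X_pos
  proof eventually_elim
    case (elim t)
    then show ?case using c by (simp add: u_def ln_div ln_realpow)
  qed
  have int_ln_u: "integrable ?T (\<lambda>t. ln (u t))"
  proof (subst integrable_cong_AE)
    show "AE t in ?T. ln (u t) = 2 * ln (norm (?X t)) - 2 * ln c"
      using ln_u by eventually_elim simp
  qed (use int_ln_X in auto)
  have val_ln_u: "(\<integral>t. ln (u t) \<partial>?T) = 2 * (\<integral>t. ln (norm (?X t)) \<partial>?T) - 2 * ln c"
  proof -
    have "(\<integral>t. ln (u t) \<partial>?T) = (\<integral>t. 2 * ln (norm (?X t)) - 2 * ln c \<partial>?T)"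
      using ln_u by (intro integral_cong_AE) (auto elim: eventually_mono)
    then show ?thesis using int_ln_X by (simp add: P.prob_space)
  qed
  have u_pow: "u t ^ k = norm (?X t) ^ (2 * k) / c ^ (2 * k)" for t k
    by (simp add: u_def power_divide power_mult)
  have int_u: "integrable ?T (\<lambda>t. u t ^ k)" for k
    unfolding u_pow using torus_form_moment(1)[of "{..n}" D k] by simp
  have val_u: "(\<integral>t. u t ^ k \<partial>?T) = a_coeff n k D / c ^ (2 * k)" for k
    unfolding u_pow a_coeff_eq_moment by simp
  have int_jac: "integrable ?T (\<lambda>t. jacobi_poly j (u t))" for j
    unfolding jacobi_poly_def using int_u by auto
  have S: "S_term n D j = (\<integral>t. 2 / real j * jacobi_poly j (u t) \<partial>?T)" for j
  proof -
    have "(\<integral>t. jacobi_poly j (u t) \<partial>?T) = (\<Sum>k\<le>j. \<integral>t. real ((j + k - 1) choose k) * real (j choose k) *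
        ((- 1) ^ k * u t ^ k) \<partial>?T)"
      unfolding jacobi_poly_def
      by (intro Bochner_Integration.integral_sum integrable_mult_right int_u)
    also have "\<dots> = (\<Sum>k\<le>j. real ((j + k - 1) choose k) * real (j choose k) *
        ((- 1) ^ k * a_coeff n k D / c_const n D ^ (2 * k)))"
      by (simp only: integral_mult_right_zero val_u c_def times_divide_eq_right)
    finally show ?thesis unfolding S_term_def integral_mult_right_zero by (simp only:)
  qed
  let ?s = "\<lambda>J t. \<Sum>i<J. 2 / real (Suc i) * jacobi_poly (Suc i) (u t)"
  \<comment> \<open>The majorant \<open>10 - ln (u t)\<close> bounds all partial sums and is
    integrable by \<open>int_ln_u\<close>.\<close>
  have "(\<lambda>J. \<integral>t. ?s J t \<partial>?T) \<longlonglongrightarrow> (\<integral>t. - ln (u t) \<partial>?T)"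
  proof (rule integral_dominated_convergence)
    show "integrable ?T (\<lambda>t. 10 - ln (u t))" using int_ln_u by auto
    show "(\<lambda>t. - ln (u t)) \<in> borel_measurable ?T" by measurable
    show "?s J \<in> borel_measurable ?T" for J
      using int_jac by (intro borel_measurable_integrable) auto
    show "AE t in ?T. (\<lambda>J. ?s J t) \<longlonglongrightarrow> - ln (u t)"
      using ln_u by eventually_elim (intro jacobi_poly_log_series(1) u_le, blast)
    show "AE t in ?T. norm (?s J t) \<le> 10 - ln (u t)" for J
      using ln_u unfolding real_norm_def
      by eventually_elim (intro jacobi_poly_log_series(2) u_le, blast)
  qed
  moreover have "(\<integral>t. ?s J t \<partial>?T) = (\<Sum>i<J. S_term n D (Suc i))" for J
    unfolding S using int_jac by (subst Bochner_Integration.integral_sum) auto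
  ultimately have sums: "(\<lambda>i. S_term n D (Suc i)) sums (2 * ln c - 2 * (\<integral>t. ln (norm (?X t)) \<partial>?T))"
    unfolding sums_def using val_ln_u by simp
  have "(\<integral>t. ln (norm (?X t)) \<partial>?T) =
      (LINT t:(\<Pi>\<^sub>E i\<in>{..n}. {0..2 * pi})|(\<Pi>\<^sub>M i\<in>{..n}. lborel). ln (norm (?X t))) /\<^sub>R (2 * pi) ^ card {..n}"
    by (rule integral_torus) measurable
  \<comment> \<open>The variables \<open>{..<n + 1}\<close> of the polynomial ring are the indices
    \<open>{..n}\<close>, and \<open>card {..n} = n + 1\<close> matches the power of
    \<open>2 * pi\<close>.\<close>
  then have "log_mahler_measure (n + 1) (linear_form n D) = (\<integral>t. ln (norm (?X t)) \<partial>?T)"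
    unfolding log_mahler_measure_def eval_cpoly_linear_form Suc_eq_plus1[symmetric] lessThan_Suc_atMost
    by (simp only: torus_form_def real_scaleR_def divide_inverse mult_1_left card_atMost)
  moreover have "S0 n D = 2 * ln c - 2 * (\<integral>t. ln (norm (?X t)) \<partial>?T)"
    using sums_unique[OF sums] by (simp add: S0_def)
  ultimately show ?thesis using sums_summable[OF sums] by (simp add: c_def field_simps)
qed

end
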